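(* Let $n\ge 2$, let $\Omega\subset\mathbb{R}^n$ be a bounded open set, let $\alpha\in(0,n)$ and let $1<q<\infty$. Let $\nu$ be a positive Borel measure on $\Omega$ for which there are $d\in(0,n]$ and a constant $C_d'>0$ with $\nu(B(x,r))\le C_d' r^d$ for all $x\in\mathbb{R}^n$ and all $r>0$. Then there exists a positive constant $C=C(n,\alpha,\Omega,C_d',q)$ such that $$\left(\int_0^{\nu(\Omega)}\frac{\left((I_\alpha f)_\nu^*(t)\right)^q}{\left(1+\left|\log\frac{t}{\nu(\Omega)}\right|\right)^q}\,\frac{dt}{t}\right)^{\frac1q}\le C\,\|f\|_{L^{\frac n\alpha,q}(\Omega)}$$ for every $f\in L^{\frac n\alpha,q}(\Omega)$.
   Context: $B(x,r)$ is the ball of radius $r$ centered at $x$; $\nu$ is regarded as a measure on $\mathbb{R}^n$ vanishing outside $\Omega$, so $\nu(B(x,r))=\nu(B(x,r)\cap\Omega)$. $|E|$ is the Lebesgue measure of $E$. $C=C(\dots)$ means a constant depending only on the listed quantities (dependence on $C_d'$ being understood together with its exponent $d$). For $\alpha\in(0,n)$, the Riesz potential is $I_\alpha f(x)=\frac1{\gamma(\alpha)}\int_{\mathbb{R}^n}\frac{f(y)}{|x-y|^{n-\alpha}}\,dy$ with $\gamma(\alpha)=\frac{\pi^{n/2}2^\alpha\Gamma(\alpha/2)}{\Gamma\left(\frac{n-\alpha}{2}\right)}$; a function $f$ on $\Omega$ is extended by $0$ to $\mathbb{R}^n$. For a $\nu$-measurable function $g$ on $\Omega$ and $t>0$, $g_\nu^*(t)=\inf\{\lambda>0:\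 \nu(\{x\in\Omega:|g(x)|>\lambda\})\le t\}$. For a Lebesgue measurable $g$ on $\Omega$, $g^*(t)=\inf\{\lambda>0:\ |\{x\in\Omega:|g(x)|>\lambda\}|\le t\}$. For $1\le p<\infty$ and $1\le q<\infty$, $L^{p,q}(\Omega)$ is the space of measurable $g$ with $\|g\|_{L^{p,q}(\Omega)}=\left(\int_0^{|\Omega|}(s^{1/p}g^*(s))^q\,\frac{ds}{s}\right)^{1/q}<\infty$.
   Formalization: The constant C may also depend on the total mass ν(Ω); with only the listed dependencies the claim fails (take ν = Lebesgue measure on B(0,ε), d = n, f = |x|^{-α}/log(e/|x|) on the unit ball, ε→0). *)

theory Defs
  imports "HOL-Analysis.Analysis"
begin

text \<open>Real powers on \<^typ>\<open>ennreal\<close>; only used with a positive exponent, so the power of \<open>\<infinity>\<close> is \<open>\<infinity>\<close>.\<close>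

definition ennreal_powr :: "ennreal \<Rightarrow> real \<Rightarrow> ennreal" where
  "ennreal_powr x p = (if x = top then top else ennreal (enn2real x powr p))"

definition zero_ext :: "'a set \<Rightarrow> ('a \<Rightarrow> real) \<Rightarrow> 'a \<Rightarrow> real" where
  "zero_ext \<Omega> f = (\<lambda>x. if x \<in> \<Omega> then f x else 0)"

definition riesz_gamma :: "nat \<Rightarrow> real \<Rightarrow> real" where
  "riesz_gamma n \<alpha> =
     pi powr (real n / 2) * 2 powr \<alpha> * Gamma (\<alpha> / 2) / Gamma ((real n - \<alpha>) / 2)"

text \<open>The potential is the integral of the positive part minus the integral of the negative part,
  with values in the extended reals: the Bochner integral would silently be 0 where the integral
  diverges. Since \<^const>\<open>ennreal\<close> sends negative reals to 0, the two integrals are those of the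
  positive and negative parts. In \<^typ>\<open>ereal\<close> one has \<open>\<infinity> - \<infinity> = \<infinity>\<close>, so a point where the
  integral is undefined counts as one where the potential is infinite.\<close>

definition riesz_potential ::
    "real \<Rightarrow> ('a::euclidean_space \<Rightarrow> real) \<Rightarrow> 'a \<Rightarrow> ereal" where
  "riesz_potential \<alpha> f x =
     ereal (1 / riesz_gamma DIM('a) \<alpha>) *
       (enn2ereal (\<integral>\<^sup>+ y. ennreal (f y / norm (x - y) powr (real DIM('a) - \<alpha>)) \<partial>lebesgue)
        - enn2ereal (\<integral>\<^sup>+ y. ennreal (- f y / norm (x - y) powr (real DIM('a) - \<alpha>)) \<partial>lebesgue))"

text \<open>The infimum of the empty set is \<open>\<infinity>\<close>.\<close>

definition rearrangement ::
    "'a measure \<Rightarrow> 'a set \<Rightarrow> ('a \<Rightarrow> ereal) \<Rightarrow> real \<Rightarrow> ennreal" where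
  "rearrangement M \<Omega> g t =
     Inf {ennreal l | l. l > 0 \<and> emeasure M {x \<in> \<Omega>. \<bar>g x\<bar> > ereal l} \<le> ennreal t}"

text \<open>Below, \<open>\<Omega>\<close> is assumed to have finite Lebesgue measure.\<close>

definition lorentz_norm ::
    "'a::euclidean_space set \<Rightarrow> real \<Rightarrow> real \<Rightarrow> ('a \<Rightarrow> real) \<Rightarrow> ennreal" where
  "lorentz_norm \<Omega> p q g =
     ennreal_powr
       (\<integral>\<^sup>+ s\<in>{0<..<measure lebesgue \<Omega>}.
          ennreal_powr (ennreal (s powr (1 / p)) * rearrangement lebesgue \<Omega> (\<lambda>x. ereal (g x)) s) q
            / ennreal s \<partial>lborel)
       (1 / q)"

definition lorentz_space ::
    "'a::euclidean_space set \<Rightarrow> real \<Rightarrow> real \<Rightarrow> ('a \<Rightarrow> real) set" where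
  "lorentz_space \<Omega> p q =
     {g \<in> borel_measurable (lebesgue_on \<Omega>). lorentz_norm \<Omega> p q g < top}"

text \<open>A Borel measure on \<open>\<Omega>\<close>, regarded as a measure on the whole space vanishing outside \<open>\<Omega>\<close>.\<close>

definition borel_measure_on :: "'a::topological_space set \<Rightarrow> 'a measure \<Rightarrow> bool" where
  "borel_measure_on \<Omega> \<nu> \<longleftrightarrow> sets \<nu> = sets borel \<and> emeasure \<nu> (- \<Omega>) = 0"

end

(* Put n = CARD('n). Since nu has finite mass, the growth exponent d may be lowered, so assume
   d < n - alpha. For sets A and E with a = nu(A) and u = |E|, integrating the kernel
   |x - y|^(alpha - n) near and far from the diagonal in the appropriate order gives
     int_A int_E |x - y|^(alpha - n) dy dnu(x) <= C a min(u^(alpha/n), (u/a)^(alpha/(n-d))).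
   Testing with A = {|I_alpha f| > l} and decomposing |f| into its level sets turns this into
     (I_alpha f)*_nu(t) <= C int_0^|Omega| s^(alpha/n) f*(s) min(1, s^eps t^(-delta)) ds/s
   with delta = alpha/(n-d) and eps = delta - alpha/n. This operator is estimated in L^q(dt/t):
   the part where s^eps <= t^delta is bounded without the logarithm, and the remaining part is,
   in logarithmic variables, the classical Hardy operator, which is why 1 + |log(t/nu(Omega))|
   has to appear. Both follow from Schur's test. *)

theory Submission
  imports Defs
begin

section \<open>Powers in the extended nonnegative reals\<close>

text \<open>The exponent n/\<alpha> is critical. The function s^(\<alpha>/n) f*(s), whose L^q(ds/s)
  norm is the Lorentz norm of f, is met by the kernel min(1, s^\<epsilon> t^(-\<delta>)), which
  equals 1 for t^(\<delta>/\<epsilon>) < s < |\<Omega>|. In the measure ds/s this range has length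
  of order log(1/t) as t tends to 0, and the logarithm in the weight pays for that length. Lowering
  d serves the far integral: the sum over dyadic shells going to infinity converges only for a
  growth exponent below n - \<alpha>. Keeping the exponent positive gives \<delta> > \<alpha>/n, so
  \<epsilon> > 0, which makes the kernel summable near s = 0. Testing on sets is enough because the
  bilinear bound is a times a factor that decreases in a: dividing by a = \<nu>(A) turns the bound
  on the integral over a level set into one on the rearrangement, without interpolation. All
  integrals are taken in \<open>ennreal\<close>, so Tonelli and Schur apply before anything is known
  to be finite.\<close>

lemma ennreal_powr_ennreal: "0 \<le> x \<Longrightarrow> ennreal_powr (ennreal x) p = ennreal (x powr p)"
  by (simp add: ennreal_powr_def)

lemma ennreal_powr_top [simp]: "ennreal_powr top p = top"
  by (simp add: ennreal_powr_def)

lemma ennreal_powr_0 [simp]: "ennreal_powr 0 p = 0"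
  by (simp add: ennreal_powr_def)

lemma ennreal_powr_mono:
  assumes "x \<le> y" "0 \<le> p"
  shows "ennreal_powr x p \<le> ennreal_powr y p"
proof (cases "y = top")
  case False
  then have "x \<noteq> top" using assms(1) by (auto simp: top_unique)
  with False show ?thesis
    using assms by (auto simp: ennreal_powr_def less_top intro!: ennreal_leI powr_mono2 enn2real_mono)
qed simp

lemma ennreal_powr_mult: "ennreal_powr (x * y) p = ennreal_powr x p * ennreal_powr y p"
proof (cases "x = 0 \<or> y = 0")
  case False
  show ?thesis
  proof (cases "x = top \<or> y = top")
    case True
    with False show ?thesis
      by (auto simp: ennreal_powr_def ennreal_mult_top ennreal_top_mult ennreal_mult_eq_top_iff
          enn2real_eq_0_iff)
  next
    case F: False
    then obtain a b where "x = ennreal a" "y = ennreal b" "0 \<le> a" "0 \<le> b"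
      by (metis ennreal_cases)
    then show ?thesis
      by (simp add: ennreal_powr_ennreal powr_mult flip: ennreal_mult)
  qed
qed auto

lemma ennreal_powr_powr_inverse:
  assumes "p \<noteq> 0"
  shows "ennreal_powr (ennreal_powr x p) (1 / p) = x"
  using assms by (cases x) (simp_all add: ennreal_powr_ennreal powr_powr)

text \<open>A crude constant suffices: x + y is at most twice the maximum, whose power is one of the
  two powers on the right.\<close>

lemma ennreal_powr_add_le:
  assumes "0 < p"
  shows "ennreal_powr (x + y) p \<le> ennreal (2 powr p) * (ennreal_powr x p + ennreal_powr y p)"
proof -
  have 2: "ennreal_powr 2 p = ennreal (2 powr p)"
    using ennreal_powr_ennreal[of 2 p] by simp
  have "x + y \<le> 2 * max x y"
    by (metis add_mono max.cobounded1 max.cobounded2 mult_2)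
  then have "ennreal_powr (x + y) p \<le> ennreal_powr (2 * max x y) p"
    using assms by (intro ennreal_powr_mono) auto
  also have "\<dots> = ennreal (2 powr p) * ennreal_powr (max x y) p"
    by (simp add: ennreal_powr_mult 2)
  also have "ennreal_powr (max x y) p \<le> ennreal_powr x p + ennreal_powr y p"
    by (simp add: max_def)
  finally show ?thesis
    by (simp add: mult_left_mono)
qed

lemma borel_measurable_ennreal_powr [measurable (raw)]:
  assumes [measurable]: "f \<in> borel_measurable M"
  shows "(\<lambda>x. ennreal_powr (f x) p) \<in> borel_measurable M"
  unfolding ennreal_powr_def by measurable

section \<open>Inequalities of Young and Jensen\<close>

text \<open>Young's inequality for the product of x / l and 1, multiplied by l. The parameter l
  stays free so that it can be optimised after integration.\<close>

lemma ennreal_Young: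
  fixes l q :: real and x :: ennreal
  assumes "1 < q" "0 < l"
  shows "x \<le> ennreal (l powr (1 - q) / q) * ennreal_powr x q + ennreal (l * (1 - 1 / q))"
proof (cases x)
  case (real a)
  have "a / l \<le> (a / l) powr q / q + 1 powr (q / (q - 1)) / (q / (q - 1))"
    using Youngs_inequality[of q "q / (q - 1)" "a / l" 1] assms real by (simp add: field_simps)
  then have "a \<le> l * ((a / l) powr q / q + 1 powr (q / (q - 1)) / (q / (q - 1)))"
    using assms by (simp add: field_simps)
  also have "\<dots> = l powr (1 - q) / q * a powr q + l * (1 - 1 / q)"
    using assms real by (simp add: powr_divide powr_diff field_simps)
  finally show ?thesis
    using real assms
    by (simp add: ennreal_powr_ennreal flip: ennreal_mult ennreal_plus)
next
  case top
  then show ?thesis using assms by (simp add: ennreal_mult_top)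
qed

text \<open>Jensen's inequality for the measure with density \<open>k\<close>, whose mass is at most
  \<open>B\<close>. Integrating \<open>ennreal_Young\<close> against \<open>k\<close> gives a family
  of bounds indexed by l, and the best l yields the claim.\<close>

lemma nn_integral_powr_Jensen:
  fixes g k :: "'a \<Rightarrow> ennreal"
  assumes [measurable]: "g \<in> borel_measurable M" "k \<in> borel_measurable M"
    and q: "1 < q" and B: "0 < B" "(\<integral>\<^sup>+ x. k x \<partial>M) \<le> ennreal B"
  shows "ennreal_powr (\<integral>\<^sup>+ x. g x * k x \<partial>M) q
     \<le> ennreal (B powr (q - 1)) * (\<integral>\<^sup>+ x. ennreal_powr (g x) q * k x \<partial>M)"
    (is "ennreal_powr ?I q \<le> _ * ?G")
proof -
  have *: "?I \<le> ennreal (l powr (1 - q) / q) * ?G + ennreal (l * (1 - 1 / q) * B)" if l: "0 < l" for l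
  proof -
    have "?I \<le> (\<integral>\<^sup>+ x. ennreal (l powr (1 - q) / q) * (ennreal_powr (g x) q * k x)
                + ennreal (l * (1 - 1 / q)) * k x \<partial>M)"
    proof (rule nn_integral_mono)
      fix x
      have "g x * k x
        \<le> (ennreal (l powr (1 - q) / q) * ennreal_powr (g x) q + ennreal (l * (1 - 1 / q))) * k x"
        by (intro mult_right_mono ennreal_Young q l) auto
      then show "g x * k x \<le> ennreal (l powr (1 - q) / q) * (ennreal_powr (g x) q * k x)
                + ennreal (l * (1 - 1 / q)) * k x"
        by (simp add: algebra_simps)
    qed
    also have "\<dots> = ennreal (l powr (1 - q) / q) * ?G + ennreal (l * (1 - 1 / q)) * (\<integral>\<^sup>+ x. k x \<partial>M)"
      by (subst nn_integral_add) (auto simp: nn_integral_cmult)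
    also have "\<dots> \<le> ennreal (l powr (1 - q) / q) * ?G + ennreal (l * (1 - 1 / q)) * ennreal B"
      by (intro add_left_mono mult_left_mono B) auto
    finally show ?thesis
      using q l B by (simp add: ennreal_mult)
  qed
  show ?thesis
  proof (cases ?G)
    case top
    then show ?thesis using B by (simp add: ennreal_mult_top)
  next
    case (real G)
    show ?thesis
    proof (cases "G = 0")
      \<comment> \<open>Here the optimal l would be 0, which \<open>ennreal_Young\<close> excludes;
        but then \<open>g x * k x\<close> vanishes almost everywhere.\<close>
      case True
      then have "AE x in M. ennreal_powr (g x) q * k x = 0"
        using real by (intro nn_integral_0_iff_AE[THEN iffD1]) auto
      then have "AE x in M. g x * k x = 0"
      proof eventually_elim
        case (elim x)
        then show ?case
          using ennreal_powr_powr_inverse[of q "g x"] q by auto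
      qed
      then have "?I = 0"
        by (subst nn_integral_0_iff_AE) auto
      then show ?thesis by simp
    next
      case False
      then have G: "G > 0" using real by simp
      \<comment> \<open>The minimiser in l of l^(1-q) G / q + l (1 - 1/q) B; the minimum is l
        B.\<close>
      define l where "l = (G / B) powr (1 / q)"
      have l: "l > 0" using G B by (simp add: l_def)
      have lq: "l powr q = G / B" using G B q by (simp add: l_def powr_powr)
      have "l powr (1 - q) / q * G = l * B / q"
        using lq l B G by (simp add: powr_diff)
      then have "l powr (1 - q) / q * G + l * (1 - 1 / q) * B = l * B"
        using q by (simp add: field_simps)
      then have "?I \<le> ennreal (l * B)"
        using *[OF l] real q l B by (simp flip: ennreal_mult ennreal_plus)
      then have "ennreal_powr ?I q \<le> ennreal_powr (ennreal (l * B)) q"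
        using q by (intro ennreal_powr_mono) auto
      also have "\<dots> = ennreal ((l * B) powr q)"
        using l B by (simp add: ennreal_powr_ennreal)
      also have "(l * B) powr q = B powr (q - 1) * G"
        using l B lq by (simp add: powr_mult powr_diff)
      finally show ?thesis
        using real by (simp add: ennreal_mult)
    qed
  qed
qed

section \<open>Integrals of the Riesz kernel\<close>

lemma exists_shell_inside:
  fixes z \<rho> :: real
  assumes "0 < z" "z < \<rho>"
  shows "\<exists>j. \<rho> * (1/2) ^ j / 2 \<le> z \<and> z < \<rho> * (1/2) ^ j"
proof -
  obtain k where "(1/2) ^ k < z / \<rho>"
    using real_arch_pow_inv[of "z / \<rho>" "1/2"] assms by auto
  then have ex: "\<exists>k. \<rho> * (1/2) ^ k \<le> z"
    using assms by (auto simp: field_simps intro!: exI[of _ k])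
  define k where "k = (LEAST k. \<rho> * (1/2) ^ k \<le> z)"
  have k: "\<rho> * (1/2) ^ k \<le> z"
    unfolding k_def by (rule LeastI_ex[OF ex])
  then have "k \<noteq> 0" using assms by (intro notI) auto
  then obtain j where j: "k = Suc j" by (cases k) auto
  then have "\<not> \<rho> * (1/2) ^ j \<le> z"
    using not_less_Least[of j "\<lambda>k. \<rho> * (1/2) ^ k \<le> z"] by (simp add: k_def)
  with k j show ?thesis by (intro exI[of _ j]) auto
qed

text \<open>The radii start at \<open>2 * \<rho>\<close>, so that the innermost shell is [\<rho>,
  2\<rho>).\<close>

lemma exists_shell_outside:
  fixes z \<rho> :: real
  assumes "0 < \<rho>" "\<rho> \<le> z"
  shows "\<exists>j. (2 * \<rho>) * 2 ^ j / 2 \<le> z \<and> z < (2 * \<rho>) * 2 ^ j"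
proof -
  obtain k where "z / (2 * \<rho>) < 2 ^ k"
    using real_arch_pow[of 2 "z / (2 * \<rho>)"] by auto
  then have ex: "\<exists>k. z < (2 * \<rho>) * 2 ^ k"
    using assms by (auto simp: field_simps intro!: exI[of _ k])
  define k where "k = (LEAST k. z < (2 * \<rho>) * 2 ^ k)"
  have k: "z < (2 * \<rho>) * 2 ^ k"
    unfolding k_def by (rule LeastI_ex[OF ex])
  have "(2 * \<rho>) * 2 ^ k / 2 \<le> z"
  proof (cases k)
    case (Suc j)
    then have "\<not> z < (2 * \<rho>) * 2 ^ j"
      using not_less_Least[of j "\<lambda>k. z < (2 * \<rho>) * 2 ^ k"] by (simp add: k_def)
    with Suc show ?thesis by simp
  qed (use assms in auto)
  with k show ?thesis by blast
qed

lemma ennreal_le_suminf: "f j \<le> (\<Sum>i. f i :: ennreal)"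
  using sum_le_suminf[of f "{j}"] by simp

text \<open>On the shell of outer radius r the integrand is at most (r/2)^(-\<kappa>), and the shell
  lies in the ball of radius r, of measure at most c r^D. The shells thus contribute a geometric
  series of ratio b^(D-\<kappa>). With b = 1/2 this covers a ball and needs \<kappa> < D; with b = 2
  it covers the exterior of a ball and needs D < \<kappa>.\<close>

lemma nn_integral_shells_le:
  fixes x :: "'a::euclidean_space"
  assumes sub: "sets borel \<subseteq> sets \<mu>"
    and growth: "\<And>r. 0 < r \<Longrightarrow> emeasure \<mu> (ball x r) \<le> ennreal (c * r powr D)"
    and pos: "0 \<le> c" "0 \<le> \<kappa>" "0 < \<rho>" "0 < b" "b powr (D - \<kappa>) < 1"
    and shell: "\<And>y. y \<in> S \<Longrightarrow> y \<noteq> x \<Longrightarrow> \<exists>j. \<rho> * b ^ j / 2 \<le> norm (x - y) \<and> norm (x - y) < \<rho> * b ^ j"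
  shows "(\<integral>\<^sup>+ y\<in>S. ennreal (norm (x - y) powr - \<kappa>) \<partial>\<mu>)
    \<le> ennreal (c * 2 powr \<kappa> / (1 - b powr (D - \<kappa>)) * \<rho> powr (D - \<kappa>))"
proof -
  define r where "r j = \<rho> * b ^ j" for j
  have r: "r j > 0" for j using pos by (simp add: r_def)
  have ball_sets: "ball x s \<in> sets \<mu>" for s
    using sub by auto
  have meas: "(\<lambda>y. ennreal ((r j / 2) powr - \<kappa>) * indicator (ball x (r j)) y) \<in> borel_measurable \<mu>" for j
    using ball_sets[of "r j"] by measurable
  have "(\<integral>\<^sup>+ y\<in>S. ennreal (norm (x - y) powr - \<kappa>) \<partial>\<mu>)
      \<le> (\<integral>\<^sup>+ y. (\<Sum>j. ennreal ((r j / 2) powr - \<kappa>) * indicator (ball x (r j)) y) \<partial>\<mu>)"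
  proof (rule nn_integral_mono)
    fix y
    show "ennreal (norm (x - y) powr - \<kappa>) * indicator S y
       \<le> (\<Sum>j. ennreal ((r j / 2) powr - \<kappa>) * indicator (ball x (r j)) y)"
    proof (cases "y \<in> S \<and> y \<noteq> x")
      case True
      then obtain j where j: "r j / 2 \<le> norm (x - y)" "norm (x - y) < r j"
        using shell unfolding r_def by blast
      have "norm (x - y) powr - \<kappa> \<le> (r j / 2) powr - \<kappa>"
        using j r[of j] pos by (intro powr_mono2') auto
      then have "ennreal (norm (x - y) powr - \<kappa>) * indicator S y
          \<le> ennreal ((r j / 2) powr - \<kappa>) * indicator (ball x (r j)) y"
        using True j by (simp add: dist_norm ennreal_leI)
      also have "\<dots> \<le> (\<Sum>i. ennreal ((r i / 2) powr - \<kappa>) * indicator (ball x (r i)) y)"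
        by (rule ennreal_le_suminf)
      finally show ?thesis .
    \<comment> \<open>At y = x the integrand is 0, because \<open>0 powr - \<kappa> = 0\<close>, so
      the centre may be left out of all shells.\<close>
    qed (auto simp: indicator_def)
  qed
  also have "\<dots> = (\<Sum>j. ennreal ((r j / 2) powr - \<kappa>) * emeasure \<mu> (ball x (r j)))"
    by (simp only: nn_integral_suminf[OF meas] nn_integral_cmult_indicator[OF ball_sets])
  also have "\<dots> \<le> (\<Sum>j. ennreal (c * 2 powr \<kappa> * \<rho> powr (D - \<kappa>) * (b powr (D - \<kappa>)) ^ j))"
  proof (rule suminf_le)
    fix j
    have "ennreal ((r j / 2) powr - \<kappa>) * emeasure \<mu> (ball x (r j))
        \<le> ennreal ((r j / 2) powr - \<kappa>) * ennreal (c * r j powr D)"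
      by (intro mult_left_mono growth r) auto
    also have "\<dots> = ennreal ((r j / 2) powr - \<kappa> * (c * r j powr D))"
      using pos by (simp add: ennreal_mult)
    also have "(r j / 2) powr - \<kappa> * (c * r j powr D) = c * 2 powr \<kappa> * r j powr (D - \<kappa>)"
      using r[of j] by (simp add: powr_divide powr_minus powr_diff divide_simps)
    also have "r j powr (D - \<kappa>) = \<rho> powr (D - \<kappa>) * (b powr (D - \<kappa>)) ^ j"
    proof -
      have "(b ^ j) powr (D - \<kappa>) = (b powr (D - \<kappa>)) ^ j"
        using pos by (simp add: powr_powr powr_realpow[symmetric] mult.commute[of "real j"])
      then show ?thesis using pos by (simp add: r_def powr_mult)
    qed
    finally show "ennreal ((r j / 2) powr - \<kappa>) * emeasure \<mu> (ball x (r j))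
        \<le> ennreal (c * 2 powr \<kappa> * \<rho> powr (D - \<kappa>) * (b powr (D - \<kappa>)) ^ j)"
      by (simp add: mult.assoc)
  qed auto
  also have "\<dots> = ennreal (c * 2 powr \<kappa> * \<rho> powr (D - \<kappa>) * (1 / (1 - b powr (D - \<kappa>))))"
    using pos by (intro suminf_ennreal_eq sums_mult geometric_sums) auto
  finally show ?thesis by (simp add: field_simps)
qed

lemma nn_integral_ball_powr_le:
  fixes x :: "'a::euclidean_space"
  assumes "sets borel \<subseteq> sets \<mu>"
    and "\<And>r. 0 < r \<Longrightarrow> emeasure \<mu> (ball x r) \<le> ennreal (c * r powr D)"
    and "0 \<le> c" "0 \<le> \<kappa>" "\<kappa> < D" "0 < \<rho>"
  shows "(\<integral>\<^sup>+ y\<in>ball x \<rho>. ennreal (norm (x - y) powr - \<kappa>) \<partial>\<mu>)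
    \<le> ennreal (c * 2 powr \<kappa> / (1 - (1/2) powr (D - \<kappa>)) * \<rho> powr (D - \<kappa>))"
proof (rule nn_integral_shells_le)
  show "(1/2) powr (D - \<kappa>) < (1::real)"
    using assms powr_less_mono2[of "D - \<kappa>" "1/2" "1::real"] by simp
  show "\<exists>j. \<rho> * (1/2) ^ j / 2 \<le> norm (x - y) \<and> norm (x - y) < \<rho> * (1/2) ^ j"
    if "y \<in> ball x \<rho>" "y \<noteq> x" for y
    using that by (intro exists_shell_inside) (auto simp: dist_norm)
qed (use assms in auto)

text \<open>With \<kappa> = n - \<alpha>, the condition D < \<kappa> is the reason for lowering the
  growth exponent of \<nu>.\<close>

lemma nn_integral_outside_ball_powr_le:
  fixes x :: "'a::euclidean_space"
  assumes "sets borel \<subseteq> sets \<mu>"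
    and "\<And>r. 0 < r \<Longrightarrow> emeasure \<mu> (ball x r) \<le> ennreal (c * r powr D)"
    and "0 \<le> c" "0 \<le> \<kappa>" "D < \<kappa>" "0 < \<rho>"
  shows "(\<integral>\<^sup>+ y\<in>- ball x \<rho>. ennreal (norm (x - y) powr - \<kappa>) \<partial>\<mu>)
    \<le> ennreal (c * 2 powr \<kappa> / (1 - 2 powr (D - \<kappa>)) * (2 powr (D - \<kappa>)) * \<rho> powr (D - \<kappa>))"
proof -
  have "(\<integral>\<^sup>+ y\<in>- ball x \<rho>. ennreal (norm (x - y) powr - \<kappa>) \<partial>\<mu>)
    \<le> ennreal (c * 2 powr \<kappa> / (1 - 2 powr (D - \<kappa>)) * (2 * \<rho>) powr (D - \<kappa>))"
  proof (rule nn_integral_shells_le)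
    show "2 powr (D - \<kappa>) < (1::real)"
      using assms powr_less_mono[of "D - \<kappa>" 0 "2::real"] by simp
    show "\<exists>j. (2 * \<rho>) * 2 ^ j / 2 \<le> norm (x - y) \<and> norm (x - y) < (2 * \<rho>) * 2 ^ j"
      if "y \<in> - ball x \<rho>" for y
      using that assms by (intro exists_shell_outside) (auto simp: dist_norm)
  qed (use assms in auto)
  then show ?thesis using assms by (simp add: powr_mult mult.assoc)
qed

text \<open>On the diagonal the kernel is \<open>0\<close>, since \<open>0 powr a = 0\<close>.\<close>

definition riesz_kernel :: "real \<Rightarrow> 'a::euclidean_space \<Rightarrow> 'a \<Rightarrow> ennreal" where
  "riesz_kernel \<alpha> x y = ennreal (norm (x - y) powr - (real DIM('a) - \<alpha>))"

lemma riesz_kernel_commute: "riesz_kernel \<alpha> x y = riesz_kernel \<alpha> y x"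
  by (simp add: riesz_kernel_def norm_minus_commute)

lemma measurable_riesz_kernel [measurable (raw)]:
  fixes f g :: "'b \<Rightarrow> 'a::euclidean_space"
  assumes "f \<in> borel_measurable M" "g \<in> borel_measurable M"
  shows "(\<lambda>z. riesz_kernel \<alpha> (f z) (g z)) \<in> borel_measurable M"
  using assms unfolding riesz_kernel_def by measurable

lemma measurable_pred_ball [measurable (raw)]:
  fixes f g :: "'b \<Rightarrow> 'a::euclidean_space"
  assumes "f \<in> borel_measurable M" "g \<in> borel_measurable M"
  shows "Measurable.pred M (\<lambda>z. g z \<in> ball (f z) r)"
  using assms unfolding mem_ball by measurable

lemma emeasure_lborel_ball_powr:
  fixes x :: "'a::euclidean_space"
  assumes "0 < r"
  shows "emeasure lborel (ball x r) = ennreal (unit_ball_vol (DIM('a)) * r powr real DIM('a))"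
  using assms emeasure_ball[of r x] by (simp add: powr_realpow)

section \<open>The Riesz kernel tested on one set and on a pair of sets\<close>

text \<open>The ball estimate for Lebesgue measure: D = n and \<kappa> = n - \<alpha>, which leaves
  the exponent D - \<kappa> = \<alpha>.\<close>

lemma riesz_kernel_near:
  assumes "0 < \<alpha>" "\<alpha> < real DIM('a::euclidean_space)"
  obtains C where "0 < C"
    "\<And>\<rho> (x::'a). 0 < \<rho> \<Longrightarrow> (\<integral>\<^sup>+ y\<in>ball x \<rho>. riesz_kernel \<alpha> x y \<partial>lborel) \<le> ennreal (C * \<rho> powr \<alpha>)"
proof
  let ?C = "unit_ball_vol (DIM('a)) * 2 powr (real DIM('a) - \<alpha>) / (1 - (1/2) powr \<alpha>)"
  show "?C > 0"
    using assms powr_less_mono2[of \<alpha> "1/2" "1::real"] by simp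
  fix \<rho> :: real and x :: 'a assume "0 < \<rho>"
  then show "(\<integral>\<^sup>+ y\<in>ball x \<rho>. riesz_kernel \<alpha> x y \<partial>lborel) \<le> ennreal (?C * \<rho> powr \<alpha>)"
    using nn_integral_ball_powr_le[of "lborel :: 'a measure" x "unit_ball_vol (DIM('a))" "real DIM('a)"
        "real DIM('a) - \<alpha>" \<rho>, OF _ eq_refl[OF emeasure_lborel_ball_powr]] assms
    by (simp add: riesz_kernel_def)
qed

text \<open>Inside a ball around x use \<open>riesz_kernel_near\<close>; outside it the kernel is at
  most its value on the sphere, which is multiplied by the measure of E. In the final constant,
  \<open>C\<close> comes from the ball and 1 from the rest.\<close>

lemma riesz_kernel_set_le:
  assumes "0 < \<alpha>" "\<alpha> < real DIM('a::euclidean_space)"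
  obtains C where "0 < C"
    "\<And>E u (x::'a). E \<in> sets borel \<Longrightarrow> emeasure lborel E \<le> ennreal u \<Longrightarrow> 0 < u \<Longrightarrow>
       (\<integral>\<^sup>+ y\<in>E. riesz_kernel \<alpha> x y \<partial>lborel) \<le> ennreal (C * u powr (\<alpha> / real DIM('a)))"
proof -
  obtain C where C: "0 < C" and near: "\<And>\<rho> (x::'a). 0 < \<rho> \<Longrightarrow>
      (\<integral>\<^sup>+ y\<in>ball x \<rho>. riesz_kernel \<alpha> x y \<partial>lborel) \<le> ennreal (C * \<rho> powr \<alpha>)"
    by (rule riesz_kernel_near[OF assms]) (rule that)
  let ?n = "real DIM('a)"
  show ?thesis
  proof (rule that[of "C + 1"])
    fix E :: "'a set" and u :: real and x :: 'a
    assume E[measurable]: "E \<in> sets borel" and u: "emeasure lborel E \<le> ennreal u" "0 < u"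
    \<comment> \<open>the radius at which the near and the far part have the same size\<close>
    define \<rho> where "\<rho> = u powr (1 / ?n)"
    have \<rho>: "0 < \<rho>" using u by (simp add: \<rho>_def)
    have "(\<integral>\<^sup>+ y\<in>E. riesz_kernel \<alpha> x y \<partial>lborel)
       \<le> (\<integral>\<^sup>+ y. riesz_kernel \<alpha> x y * indicator (ball x \<rho>) y
              + ennreal (\<rho> powr - (?n - \<alpha>)) * indicator E y \<partial>lborel)"
    proof (intro nn_integral_mono)
      fix y
      show "riesz_kernel \<alpha> x y * indicator E y \<le> riesz_kernel \<alpha> x y * indicator (ball x \<rho>) y
              + ennreal (\<rho> powr - (?n - \<alpha>)) * indicator E y"
      proof (cases "y \<in> ball x \<rho>")
        case False
        then have "norm (x - y) powr - (?n - \<alpha>) \<le> \<rho> powr - (?n - \<alpha>)"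
          using \<rho> assms by (intro powr_mono2') (auto simp: dist_norm)
        then have "riesz_kernel \<alpha> x y \<le> ennreal (\<rho> powr - (?n - \<alpha>))"
          unfolding riesz_kernel_def by (rule ennreal_leI)
        with False show ?thesis by (auto simp: indicator_def)
      qed (simp add: indicator_def)
    qed
    also have "\<dots> = (\<integral>\<^sup>+ y\<in>ball x \<rho>. riesz_kernel \<alpha> x y \<partial>lborel)
        + ennreal (\<rho> powr - (?n - \<alpha>)) * emeasure lborel E"
      by (subst nn_integral_add) (auto simp: nn_integral_cmult_indicator)
    also have "\<dots> \<le> ennreal (C * \<rho> powr \<alpha>) + ennreal (\<rho> powr - (?n - \<alpha>)) * ennreal u"
      by (intro add_mono near \<rho> mult_left_mono u) auto
    also have "\<dots> = ennreal (C * \<rho> powr \<alpha> + \<rho> powr - (?n - \<alpha>) * u)"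
      using C u by (simp add: ennreal_mult)
    also have "\<rho> powr - (?n - \<alpha>) = u powr (\<alpha> / ?n - 1)"
      by (simp add: \<rho>_def powr_powr diff_divide_distrib)
    also have "u powr (\<alpha> / ?n - 1) * u = u powr (\<alpha> / ?n)"
      using u by (simp add: powr_diff)
    also have "\<rho> powr \<alpha> = u powr (\<alpha> / ?n)"
      using u by (simp add: \<rho>_def powr_powr)
    finally show "(\<integral>\<^sup>+ y\<in>E. riesz_kernel \<alpha> x y \<partial>lborel) \<le> ennreal ((C + 1) * u powr (\<alpha> / ?n))"
      by (simp add: algebra_simps)
  qed (use C in auto)
qed

text \<open>The first entry of the minimum is \<open>riesz_kernel_set_le\<close> integrated over A.
  The second uses the growth of \<nu> around points y of E, for those x that are far from y. The
  constant is obtained before \<nu>, so it depends on \<nu> only through \<open>c\<close> and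
  \<open>D\<close>.\<close>

lemma riesz_kernel_bilinear_le:
  fixes \<alpha> c D :: real
  assumes \<alpha>: "0 < \<alpha>" "\<alpha> < real DIM('a::euclidean_space)"
    and D: "D < real DIM('a) - \<alpha>" and c: "0 < c"
  obtains C where "0 < C"
    "\<And>(\<nu>::'a measure) A E a u. sets \<nu> = sets borel \<Longrightarrow> finite_measure \<nu> \<Longrightarrow>
       (\<And>x r. 0 < r \<Longrightarrow> emeasure \<nu> (ball x r) \<le> ennreal (c * r powr D)) \<Longrightarrow>
       A \<in> sets borel \<Longrightarrow> E \<in> sets borel \<Longrightarrow>
       emeasure \<nu> A = ennreal a \<Longrightarrow> 0 < a \<Longrightarrow> emeasure lborel E \<le> ennreal u \<Longrightarrow> 0 < u \<Longrightarrow>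
       (\<integral>\<^sup>+ x\<in>A. \<integral>\<^sup>+ y\<in>E. riesz_kernel \<alpha> x y \<partial>lborel \<partial>\<nu>)
         \<le> ennreal (C * a * min (u powr (\<alpha> / real DIM('a))) ((u / a) powr (\<alpha> / (real DIM('a) - D))))"
proof -
  let ?n = "real DIM('a)"
  obtain C1 where C1: "0 < C1" and set_le: "\<And>E u (x::'a). E \<in> sets borel \<Longrightarrow>
      emeasure lborel E \<le> ennreal u \<Longrightarrow> 0 < u \<Longrightarrow>
       (\<integral>\<^sup>+ y\<in>E. riesz_kernel \<alpha> x y \<partial>lborel) \<le> ennreal (C1 * u powr (\<alpha> / ?n))"
    by (rule riesz_kernel_set_le[OF \<alpha>]) (rule that)
  obtain C2 where C2: "0 < C2" and near: "\<And>\<rho> (x::'a). 0 < \<rho> \<Longrightarrow>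
      (\<integral>\<^sup>+ y\<in>ball x \<rho>. riesz_kernel \<alpha> x y \<partial>lborel) \<le> ennreal (C2 * \<rho> powr \<alpha>)"
    by (rule riesz_kernel_near[OF \<alpha>]) (rule that)
  define C3 where "C3 = c * 2 powr (?n - \<alpha>) / (1 - 2 powr (D - (?n - \<alpha>))) * 2 powr (D - (?n - \<alpha>))"
  have "2 powr (D - (?n - \<alpha>)) < 1"
    using D powr_less_mono[of "D - (?n - \<alpha>)" 0 2] by simp
  then have C3: "0 < C3" using c by (simp add: C3_def)
  show ?thesis
  proof (rule that[of "max C1 (C2 + C3)"])
    fix \<nu> :: "'a measure" and A E :: "'a set" and a u :: real
    assume \<nu>[measurable_cong]: "sets \<nu> = sets borel" and fin: "finite_measure \<nu>"
      and growth: "\<And>x r. 0 < r \<Longrightarrow> emeasure \<nu> (ball x r) \<le> ennreal (c * r powr D)"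
      and A[measurable]: "A \<in> sets borel" and E[measurable]: "E \<in> sets borel"
      and a: "emeasure \<nu> A = ennreal a" "0 < a" and u: "emeasure lborel E \<le> ennreal u" "0 < u"
    interpret \<nu>: finite_measure \<nu> by fact
    interpret pair_sigma_finite \<nu> "lborel :: 'a measure" ..
    let ?B = "\<integral>\<^sup>+ x\<in>A. \<integral>\<^sup>+ y\<in>E. riesz_kernel \<alpha> x y \<partial>lborel \<partial>\<nu>"
    define \<delta> where "\<delta> = \<alpha> / (?n - D)"
    have far: "(\<integral>\<^sup>+ x\<in>- ball y \<rho>. riesz_kernel \<alpha> y x \<partial>\<nu>) \<le> ennreal (C3 * \<rho> powr (D - (?n - \<alpha>)))"
      if "0 < \<rho>" for \<rho> and y :: 'a
      using nn_integral_outside_ball_powr_le[of \<nu> y c D "?n - \<alpha>" \<rho>] that \<nu> growth \<alpha> D c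
      by (simp add: riesz_kernel_def C3_def)
    have "?B \<le> (\<integral>\<^sup>+ x. ennreal (C1 * u powr (\<alpha> / ?n)) * indicator A x \<partial>\<nu>)"
      by (intro nn_integral_mono mult_right_mono set_le u) auto
    also have "\<dots> = ennreal (C1 * a * u powr (\<alpha> / ?n))"
      using C1 a A by (subst nn_integral_cmult_indicator) (auto simp: \<nu> ac_simps simp flip: ennreal_mult)
    finally have B1: "?B \<le> ennreal (C1 * a * u powr (\<alpha> / ?n))" .
    \<comment> \<open>Below \<open>\<rho>\<close> integrate first over \<open>y\<close>, which gives \<open>a * \<rho> powr \<alpha>\<close>; above \<open>\<rho>\<close> first over \<open>x\<close>,
      which gives \<open>u * \<rho> powr (D - n + \<alpha>)\<close>. This \<open>\<rho>\<close> balances the two.\<close>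
    define \<rho> where "\<rho> = (u / a) powr (1 / (?n - D))"
    have \<rho>: "0 < \<rho>" using u a by (simp add: \<rho>_def)
    \<comment> \<open>In the far term the set A is discarded and the kernel is written with y first,
      since there the x-integral will be the inner one, over the exterior of a ball centred at
      y.\<close>
    have "?B \<le> (\<integral>\<^sup>+ x. (\<integral>\<^sup>+ y\<in>ball x \<rho>. riesz_kernel \<alpha> x y \<partial>lborel) * indicator A x
        + (\<integral>\<^sup>+ y. riesz_kernel \<alpha> y x * (indicator (- ball y \<rho>) x * indicator E y) \<partial>lborel) \<partial>\<nu>)"
    proof (rule nn_integral_mono)
      fix x
      have "(\<integral>\<^sup>+ y\<in>E. riesz_kernel \<alpha> x y \<partial>lborel) * indicator A x
        \<le> (\<integral>\<^sup>+ y. riesz_kernel \<alpha> x y * indicator (ball x \<rho>) y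
           + riesz_kernel \<alpha> y x * (indicator (- ball y \<rho>) x * indicator E y) \<partial>lborel) * indicator A x"
        by (intro mult_right_mono nn_integral_mono)
           (auto simp: indicator_def dist_commute riesz_kernel_commute)
      also have "\<dots> = ((\<integral>\<^sup>+ y\<in>ball x \<rho>. riesz_kernel \<alpha> x y \<partial>lborel)
         + (\<integral>\<^sup>+ y. riesz_kernel \<alpha> y x * (indicator (- ball y \<rho>) x * indicator E y) \<partial>lborel))
           * indicator A x"
        by (subst nn_integral_add) auto
      also have "\<dots> \<le> (\<integral>\<^sup>+ y\<in>ball x \<rho>. riesz_kernel \<alpha> x y \<partial>lborel) * indicator A x
         + (\<integral>\<^sup>+ y. riesz_kernel \<alpha> y x * (indicator (- ball y \<rho>) x * indicator E y) \<partial>lborel)"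
        by (auto simp: indicator_def)
      finally show "(\<integral>\<^sup>+ y\<in>E. riesz_kernel \<alpha> x y \<partial>lborel) * indicator A x \<le> \<dots>" .
    qed
    also have "\<dots> = (\<integral>\<^sup>+ x\<in>A. (\<integral>\<^sup>+ y\<in>ball x \<rho>. riesz_kernel \<alpha> x y \<partial>lborel) \<partial>\<nu>)
        + (\<integral>\<^sup>+ x. \<integral>\<^sup>+ y. riesz_kernel \<alpha> y x * (indicator (- ball y \<rho>) x * indicator E y) \<partial>lborel \<partial>\<nu>)"
      by (subst nn_integral_add) auto
    also have "(\<integral>\<^sup>+ x. \<integral>\<^sup>+ y. riesz_kernel \<alpha> y x * (indicator (- ball y \<rho>) x * indicator E y) \<partial>lborel \<partial>\<nu>)
       = (\<integral>\<^sup>+ y. \<integral>\<^sup>+ x. riesz_kernel \<alpha> y x * (indicator (- ball y \<rho>) x * indicator E y) \<partial>\<nu> \<partial>lborel)"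
      by (rule Fubini'[symmetric]) measurable
    also have "\<dots> = (\<integral>\<^sup>+ y\<in>E. (\<integral>\<^sup>+ x\<in>- ball y \<rho>. riesz_kernel \<alpha> y x \<partial>\<nu>) \<partial>lborel)"
      by (subst nn_integral_multc[symmetric]) (auto simp: ac_simps)
    also have "\<dots> \<le> (\<integral>\<^sup>+ y. ennreal (C3 * \<rho> powr (D - (?n - \<alpha>))) * indicator E y \<partial>lborel)"
      by (intro nn_integral_mono mult_right_mono far \<rho>) auto
    also have "\<dots> = ennreal (C3 * \<rho> powr (D - (?n - \<alpha>))) * emeasure lborel E"
      by (rule nn_integral_cmult_indicator) auto
    also have "\<dots> \<le> ennreal (C3 * \<rho> powr (D - (?n - \<alpha>))) * ennreal u"
      by (intro mult_left_mono u) auto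
    also have "\<dots> = ennreal (C3 * u * \<rho> powr (D - (?n - \<alpha>)))"
      using C3 u by (simp add: ac_simps flip: ennreal_mult)
    also have "(\<integral>\<^sup>+ x\<in>A. (\<integral>\<^sup>+ y\<in>ball x \<rho>. riesz_kernel \<alpha> x y \<partial>lborel) \<partial>\<nu>)
        \<le> (\<integral>\<^sup>+ x. ennreal (C2 * \<rho> powr \<alpha>) * indicator A x \<partial>\<nu>)"
      by (intro nn_integral_mono mult_right_mono near \<rho>) auto
    also have "\<dots> = ennreal (C2 * a * \<rho> powr \<alpha>)"
      using C2 a A by (subst nn_integral_cmult_indicator) (auto simp: \<nu> ac_simps simp flip: ennreal_mult)
    finally have "?B \<le> ennreal (C2 * a * \<rho> powr \<alpha>) + ennreal (C3 * u * \<rho> powr (D - (?n - \<alpha>)))"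
      by (simp add: add_mono)
    also have "\<dots> = ennreal (C2 * a * \<rho> powr \<alpha> + C3 * u * \<rho> powr (D - (?n - \<alpha>)))"
      using C2 C3 a u by simp
    also have "\<rho> powr \<alpha> = (u / a) powr \<delta>"
      by (simp add: \<rho>_def \<delta>_def powr_powr)
    also have "\<rho> powr (D - (?n - \<alpha>)) = (u / a) powr (\<delta> - 1)"
    proof -
      have "(D - (?n - \<alpha>)) / (?n - D) = \<delta> - 1"
        using D \<alpha> by (simp add: \<delta>_def field_simps)
      then show ?thesis by (simp add: \<rho>_def powr_powr)
    qed
    also have "C3 * u * (u / a) powr (\<delta> - 1) = C3 * a * (u / a) powr \<delta>"
      using a u by (simp add: powr_diff field_simps)
    finally have B2: "?B \<le> ennreal ((C2 + C3) * a * (u / a) powr \<delta>)"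
      by (simp add: algebra_simps)
    show "?B \<le> ennreal (max C1 (C2 + C3) * a * min (u powr (\<alpha> / ?n)) ((u / a) powr (\<alpha> / (?n - D))))"
    proof (cases "u powr (\<alpha> / ?n) \<le> (u / a) powr \<delta>")
      case True
      have "?B \<le> ennreal (C1 * a * u powr (\<alpha> / ?n))" by (rule B1)
      also have "\<dots> \<le> ennreal (max C1 (C2 + C3) * a * u powr (\<alpha> / ?n))"
        using a by (intro ennreal_leI mult_right_mono) auto
      finally show ?thesis using True by (simp add: \<delta>_def min_def)
    next
      case False
      have "?B \<le> ennreal ((C2 + C3) * a * (u / a) powr \<delta>)" by (rule B2)
      also have "\<dots> \<le> ennreal (max C1 (C2 + C3) * a * (u / a) powr \<delta>)"
        using a by (intro ennreal_leI mult_right_mono) auto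
      finally show ?thesis using False by (simp add: \<delta>_def min_def)
    qed
  qed (use C1 in auto)
qed

section \<open>From pairs of sets to functions through their level sets\<close>

text \<open>F y is the length of the interval of l with 0 < l < F y. Tonelli then moves the
  l-integral outwards, first past y and then past x.\<close>

lemma riesz_kernel_layer_cake:
  fixes \<nu> :: "'a::euclidean_space measure" and F :: "'a \<Rightarrow> real"
  assumes \<nu>[measurable_cong]: "sets \<nu> = sets borel" and fin: "finite_measure \<nu>"
    and [measurable]: "A \<in> sets borel" "F \<in> borel_measurable borel" and F: "\<And>y. 0 \<le> F y"
  shows "(\<integral>\<^sup>+ x\<in>A. \<integral>\<^sup>+ y. ennreal (F y) * riesz_kernel \<alpha> x y \<partial>lborel \<partial>\<nu>)
    = (\<integral>\<^sup>+ l\<in>{0<..}. \<integral>\<^sup>+ x\<in>A. \<integral>\<^sup>+ y\<in>{y. l < F y}. riesz_kernel \<alpha> x y \<partial>lborel \<partial>\<nu> \<partial>lborel)"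
proof -
  interpret \<nu>: finite_measure \<nu> by fact
  interpret Q: pair_sigma_finite "lborel :: real measure" \<nu> ..
  let ?h = "\<lambda>l x y. indicator {0<..} l * (riesz_kernel \<alpha> x y * indicator {y. l < F y} y) :: ennreal"
  have "(\<integral>\<^sup>+ y. ennreal (F y) * riesz_kernel \<alpha> x y \<partial>lborel)
      = (\<integral>\<^sup>+ l. \<integral>\<^sup>+ y. ?h l x y \<partial>lborel \<partial>lborel)" for x
  proof -
    have "ennreal (F y) * riesz_kernel \<alpha> x y = (\<integral>\<^sup>+ l. ?h l x y \<partial>lborel)" for y
    proof -
      have "(\<integral>\<^sup>+ l. ?h l x y \<partial>lborel) = (\<integral>\<^sup>+ l. riesz_kernel \<alpha> x y * indicator {0<..<F y} l \<partial>lborel)"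
        by (intro nn_integral_cong) (auto simp: indicator_def)
      also have "\<dots> = riesz_kernel \<alpha> x y * ennreal (F y)"
        using F by (subst nn_integral_cmult_indicator) auto
      finally show ?thesis by (simp add: mult.commute)
    qed
    then show ?thesis by (simp only:) (rule lborel_pair.Fubini', measurable)
  qed
  then have "(\<integral>\<^sup>+ x\<in>A. \<integral>\<^sup>+ y. ennreal (F y) * riesz_kernel \<alpha> x y \<partial>lborel \<partial>\<nu>)
    = (\<integral>\<^sup>+ x. \<integral>\<^sup>+ l. (\<integral>\<^sup>+ y. ?h l x y \<partial>lborel) * indicator A x \<partial>lborel \<partial>\<nu>)"
    by (simp only:) (intro nn_integral_cong nn_integral_multc[symmetric], measurable)
  also have "\<dots> = (\<integral>\<^sup>+ l. \<integral>\<^sup>+ x. (\<integral>\<^sup>+ y. ?h l x y \<partial>lborel) * indicator A x \<partial>\<nu> \<partial>lborel)"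
    by (rule Q.Fubini') measurable
  also have "\<dots> = (\<integral>\<^sup>+ l\<in>{0<..}. \<integral>\<^sup>+ x\<in>A. \<integral>\<^sup>+ y\<in>{y. l < F y}. riesz_kernel \<alpha> x y \<partial>lborel \<partial>\<nu> \<partial>lborel)"
    by (intro nn_integral_cong) (auto simp: indicator_def)
  finally show ?thesis .
qed

text \<open>This writes the value at u = |{F > l}| as an integral over s < u, so that the orders of
  l and s can be exchanged and the rearrangement of F appears. As both exponents are at most 1, the
  minimum at s > u/2 is at least half of that at u. The interval (u/2, u) alone therefore
  contributes a quarter of the value at u.\<close>

lemma min_powr_le_nn_integral:
  fixes a b t u :: real
  assumes "0 < a" "a \<le> 1" "0 < b" "b \<le> 1" "0 < t" "0 \<le> u"
  shows "ennreal (min (u powr a) ((u / t) powr b))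
    \<le> 4 * (\<integral>\<^sup>+ s\<in>{0<..<u}. ennreal (min (s powr a) ((s / t) powr b) / s) \<partial>lborel)"
proof (cases "u = 0")
  case False
  then have u: "0 < u" using assms by simp
  let ?K = "\<lambda>s. min (s powr a) ((s / t) powr b)"
  have half: "?K u / 2 \<le> ?K s" if "u / 2 < s" for s
  proof -
    have *: "u powr e / 2 \<le> s powr e" if "0 < e" "e \<le> 1" for e
    proof -
      have "u powr e / 2 \<le> u powr e / 2 powr e"
        using that powr_mono[of e 1 2] by (intro divide_left_mono) auto
      also have "\<dots> = (u / 2) powr e" using u by (simp add: powr_divide)
      also have "\<dots> \<le> s powr e" using that u \<open>u / 2 < s\<close> by (intro powr_mono2) auto
      finally show ?thesis .
    qed
    have "(u / t) powr b / 2 \<le> (s / t) powr b"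
      using *[of b] assms u that by (simp add: powr_divide divide_right_mono field_simps)
    with *[of a] assms show ?thesis by (simp add: min_def split: if_splits)
  qed
  have eq: "ennreal (?K u) = 4 * (ennreal (?K u / (2 * u)) * ennreal (u / 2))"
    using u by (simp add: ennreal_mult[symmetric] flip: ennreal_numeral)
  have "ennreal (?K u / (2 * u)) * ennreal (u / 2)
      = (\<integral>\<^sup>+ s. ennreal (?K u / (2 * u)) * indicator {u/2<..<u} s \<partial>lborel)"
    using u by (subst nn_integral_cmult_indicator) auto
  also have "\<dots> \<le> (\<integral>\<^sup>+ s\<in>{0<..<u}. ennreal (?K s / s) \<partial>lborel)"
  proof (rule nn_integral_mono)
    fix s
    have "?K u / (2 * u) \<le> ?K s / s" if "u / 2 < s" "s < u"
    proof -
      have "?K u / 2 / u \<le> ?K s / s"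
        using that half[of s] u by (intro frac_le) auto
      then show ?thesis by simp
    qed
    then show "ennreal (?K u / (2 * u)) * indicator {u/2<..<u} s
        \<le> ennreal (?K s / s) * indicator {0<..<u} s"
      using u by (auto simp: indicator_def intro!: ennreal_leI)
  qed
  finally show ?thesis unfolding eq by (rule mult_left_mono) simp
qed simp

text \<open>\<open>R\<close> stands for any function that dominates the decreasing rearrangement of
  F; the last hypothesis says so through level sets. The minimum is taken at a threshold t \<le> a,
  while the outer factor remains a, so that a can be cancelled later.\<close>

lemma riesz_bilinear_rearrangement_le:
  fixes \<alpha> c D :: real
  assumes \<alpha>: "0 < \<alpha>" "\<alpha> < real DIM('a::euclidean_space)"
    and D: "D < real DIM('a) - \<alpha>" and c: "0 < c"
  obtains C where "0 < C"
    "\<And>(\<nu>::'a measure) A F a t V (R :: real \<Rightarrow> ennreal). sets \<nu> = sets borel \<Longrightarrow> finite_measure \<nu> \<Longrightarrow>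
       (\<And>x r. 0 < r \<Longrightarrow> emeasure \<nu> (ball x r) \<le> ennreal (c * r powr D)) \<Longrightarrow>
       A \<in> sets borel \<Longrightarrow> emeasure \<nu> A = ennreal a \<Longrightarrow> 0 < t \<Longrightarrow> t \<le> a \<Longrightarrow>
       F \<in> borel_measurable borel \<Longrightarrow> (\<And>y. 0 \<le> F y) \<Longrightarrow> 0 \<le> V \<Longrightarrow>
       emeasure lborel {y. 0 < F y} \<le> ennreal V \<Longrightarrow> R \<in> borel_measurable borel \<Longrightarrow>
       (\<And>l s. 0 < l \<Longrightarrow> 0 < s \<Longrightarrow> ennreal s < emeasure lborel {y. l < F y} \<Longrightarrow> ennreal l \<le> R s) \<Longrightarrow>
       (\<integral>\<^sup>+ x\<in>A. \<integral>\<^sup>+ y. ennreal (F y) * riesz_kernel \<alpha> x y \<partial>lborel \<partial>\<nu>)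
         \<le> ennreal (C * a) * (\<integral>\<^sup>+ s\<in>{0<..<V}. R s *
             ennreal (min (s powr (\<alpha> / real DIM('a))) ((s / t) powr (\<alpha> / (real DIM('a) - D))) / s) \<partial>lborel)"
proof -
  let ?n = "real DIM('a)"
  obtain C where C: "0 < C" and bil: "\<And>(\<nu>::'a measure) A E a u. sets \<nu> = sets borel \<Longrightarrow> finite_measure \<nu> \<Longrightarrow>
       (\<And>x r. 0 < r \<Longrightarrow> emeasure \<nu> (ball x r) \<le> ennreal (c * r powr D)) \<Longrightarrow>
       A \<in> sets borel \<Longrightarrow> E \<in> sets borel \<Longrightarrow>
       emeasure \<nu> A = ennreal a \<Longrightarrow> 0 < a \<Longrightarrow> emeasure lborel E \<le> ennreal u \<Longrightarrow> 0 < u \<Longrightarrow>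
       (\<integral>\<^sup>+ x\<in>A. \<integral>\<^sup>+ y\<in>E. riesz_kernel \<alpha> x y \<partial>lborel \<partial>\<nu>)
         \<le> ennreal (C * a * min (u powr (\<alpha> / ?n)) ((u / a) powr (\<alpha> / (?n - D))))"
  proof (rule riesz_kernel_bilinear_le[OF \<alpha> D c], goal_cases)
    case (1 C)
    show ?case by (rule 1(1)[OF 1(2,3)])
  qed
  show ?thesis
  proof (rule that[of "C * 4"])
    fix \<nu> :: "'a measure" and A and F :: "'a \<Rightarrow> real" and a t V and R :: "real \<Rightarrow> ennreal"
    assume \<nu>: "sets \<nu> = sets borel" "finite_measure \<nu>"
       "\<And>x r. 0 < r \<Longrightarrow> emeasure \<nu> (ball x r) \<le> ennreal (c * r powr D)"
      and A: "A \<in> sets borel" "emeasure \<nu> A = ennreal a" and t: "0 < t" "t \<le> a"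
      and F[measurable]: "F \<in> borel_measurable borel" and F0: "\<And>y. 0 \<le> F y"
      and V: "0 \<le> V" "emeasure lborel {y. 0 < F y} \<le> ennreal V"
      and R[measurable]: "R \<in> borel_measurable borel"
      and lR: "\<And>l s. 0 < l \<Longrightarrow> 0 < s \<Longrightarrow> ennreal s < emeasure lborel {y. l < F y} \<Longrightarrow> ennreal l \<le> R s"
    define K where "K s = min (s powr (\<alpha> / ?n)) ((s / t) powr (\<alpha> / (?n - D)))" for s
    have K[measurable]: "K \<in> borel_measurable borel" unfolding K_def by measurable
    have K0: "0 \<le> K s" for s by (simp add: K_def)
    \<comment> \<open>The \<open>max 0 l\<close> keeps the level sets of finite measure for every
      real l. It makes \<open>m\<close> antitone on the whole line, and hence Borel.\<close>
    define m where "m l = measure lborel {y. max 0 l < F y}" for l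
    have le_V: "emeasure lborel {y. l < F y} \<le> ennreal V" if "0 \<le> l" for l
      using that by (intro order_trans[OF emeasure_mono V(2)]) auto
    then have fin: "emeasure lborel {y. l < F y} < top" if "0 \<le> l" for l
      using that by (meson ennreal_less_top le_less_trans)
    have em: "emeasure lborel {y. l < F y} = ennreal (m l)" if "0 < l" for l
      using fin[of l] that by (simp add: m_def emeasure_eq_ennreal_measure max_def)
    have m0: "0 \<le> m l" for l by (simp add: m_def)
    have mV: "m l \<le> V" if "0 < l" for l
      using le_V[of l] em[OF that] V that by simp
    have "mono (\<lambda>l. - m l)"
    proof (rule monoI)
      fix l l' :: real assume "l \<le> l'"
      then have "{y. max 0 l' < F y} \<subseteq> {y. max 0 l < F y}" by auto
      then show "- m l \<le> - m l'"
        unfolding m_def neg_le_iff_le using fin[of "max 0 l"]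
        by (intro measure_mono_fmeasurable) (auto simp: fmeasurable_def)
    qed
    then have "(\<lambda>l. - m l) \<in> borel_measurable borel" by (rule borel_measurable_mono)
    then have m[measurable]: "m \<in> borel_measurable borel" by simp
    have B: "(\<integral>\<^sup>+ x\<in>A. \<integral>\<^sup>+ y\<in>{y. l < F y}. riesz_kernel \<alpha> x y \<partial>lborel \<partial>\<nu>) \<le> ennreal (C * a * K (m l))"
      if l: "0 < l" for l
    proof (cases "m l = 0")
      case True
      then have "{y. l < F y} \<in> null_sets lborel"
        using em[OF l] by (auto simp: null_sets_def)
      then have "(\<integral>\<^sup>+ y\<in>{y. l < F y}. riesz_kernel \<alpha> x y \<partial>lborel) = 0" for x
        by (rule nn_integral_null_set)
      then show ?thesis by simp
    next
      case False
      then have ml: "0 < m l" using m0[of l] by simp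
      have "(\<integral>\<^sup>+ x\<in>A. \<integral>\<^sup>+ y\<in>{y. l < F y}. riesz_kernel \<alpha> x y \<partial>lborel \<partial>\<nu>)
        \<le> ennreal (C * a * min (m l powr (\<alpha> / ?n)) ((m l / a) powr (\<alpha> / (?n - D))))"
        using t em[OF l] by (intro bil \<nu> A ml) auto
      \<comment> \<open>The second entry of the minimum decreases in the measure of A, so t \<le> a
        may replace a there.\<close>
      also have "\<dots> \<le> ennreal (C * a * K (m l))"
        unfolding K_def using t C ml \<alpha> D
        by (intro ennreal_leI mult_left_mono min.mono powr_mono2 divide_left_mono) auto
      finally show ?thesis .
    qed
    \<comment> \<open>The exponents are at most 1 because \<alpha> < n and D < n - \<alpha>.\<close>
    have K4: "ennreal (K u) \<le> 4 * (\<integral>\<^sup>+ s\<in>{0<..<u}. ennreal (K s / s) \<partial>lborel)" if "0 \<le> u" for u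
      unfolding K_def using that t \<alpha> D by (intro min_powr_le_nn_integral) auto
    have "(\<integral>\<^sup>+ x\<in>A. \<integral>\<^sup>+ y. ennreal (F y) * riesz_kernel \<alpha> x y \<partial>lborel \<partial>\<nu>)
      = (\<integral>\<^sup>+ l\<in>{0<..}. \<integral>\<^sup>+ x\<in>A. \<integral>\<^sup>+ y\<in>{y. l < F y}. riesz_kernel \<alpha> x y \<partial>lborel \<partial>\<nu> \<partial>lborel)"
      by (rule riesz_kernel_layer_cake[OF \<nu>(1,2) A(1) F F0])
    also have "\<dots> \<le> (\<integral>\<^sup>+ l\<in>{0<..}. ennreal (C * a) *
        (4 * (\<integral>\<^sup>+ s\<in>{0<..<m l}. ennreal (K s / s) \<partial>lborel)) \<partial>lborel)"
    proof (rule nn_integral_mono)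
      fix l :: real
      show "(\<integral>\<^sup>+ x\<in>A. \<integral>\<^sup>+ y\<in>{y. l < F y}. riesz_kernel \<alpha> x y \<partial>lborel \<partial>\<nu>) * indicator {0<..} l
        \<le> ennreal (C * a) * (4 * (\<integral>\<^sup>+ s\<in>{0<..<m l}. ennreal (K s / s) \<partial>lborel)) * indicator {0<..} l"
      proof (cases "0 < l")
        case True
        have "(\<integral>\<^sup>+ x\<in>A. \<integral>\<^sup>+ y\<in>{y. l < F y}. riesz_kernel \<alpha> x y \<partial>lborel \<partial>\<nu>) \<le> ennreal (C * a) * ennreal (K (m l))"
          using B[OF True] C t K0 by (simp add: ennreal_mult)
        also have "\<dots> \<le> ennreal (C * a) * (4 * (\<integral>\<^sup>+ s\<in>{0<..<m l}. ennreal (K s / s) \<partial>lborel))"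
          by (intro mult_left_mono K4 m0) auto
        finally show ?thesis using True by simp
      qed simp
    qed
    also have "\<dots> = ennreal (C * a) * (4 *
        (\<integral>\<^sup>+ l. \<integral>\<^sup>+ s. ennreal (K s / s) * indicator {0<..<m l} s * indicator {0<..} l \<partial>lborel \<partial>lborel))"
    proof -
      have [measurable]: "Measurable.pred (borel \<Otimes>\<^sub>M borel) (\<lambda>x. snd x \<in> {0<..<m (fst x)})"
        unfolding greaterThanLessThan_iff by measurable
      define G where "G l = (\<integral>\<^sup>+ s\<in>{0<..<m l}. ennreal (K s / s) \<partial>lborel)" for l
      have [measurable]: "G \<in> borel_measurable borel" unfolding G_def by measurable
      have "(\<integral>\<^sup>+ s. ennreal (K s / s) * indicator {0<..<m l} s * indicator {0<..} l \<partial>lborel)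
          = G l * indicator {0<..} l" for l
        unfolding G_def by (rule nn_integral_multc) measurable
      moreover have "(\<integral>\<^sup>+ l\<in>{0<..}. ennreal (C * a) * (4 * G l) \<partial>lborel)
          = (\<integral>\<^sup>+ l. ennreal (C * a) * 4 * (G l * indicator {0<..} l) \<partial>lborel)"
        by (simp add: mult.assoc)
      ultimately show ?thesis
        unfolding G_def[symmetric] by (simp add: nn_integral_cmult mult.assoc)
    qed
    also have "(\<integral>\<^sup>+ l. \<integral>\<^sup>+ s. ennreal (K s / s) * indicator {0<..<m l} s * indicator {0<..} l \<partial>lborel \<partial>lborel)
      = (\<integral>\<^sup>+ s. \<integral>\<^sup>+ l. ennreal (K s / s) * indicator {0<..<m l} s * indicator {0<..} l \<partial>lborel \<partial>lborel)"
      by (rule lborel_pair.Fubini'[symmetric]) (unfold indicator_def greaterThanLessThan_iff greaterThan_iff, measurable)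
    also have "\<dots> \<le> (\<integral>\<^sup>+ s\<in>{0<..<V}. R s * ennreal (K s / s) \<partial>lborel)"
    proof (rule nn_integral_mono)
      fix s :: real
      show "(\<integral>\<^sup>+ l. ennreal (K s / s) * indicator {0<..<m l} s * indicator {0<..} l \<partial>lborel)
         \<le> R s * ennreal (K s / s) * indicator {0<..<V} s"
      proof (cases "0 < s \<and> s < V")
        case False
        then have "(\<lambda>l. ennreal (K s / s) * indicator {0<..<m l} s * indicator {0<..} l :: ennreal) = (\<lambda>_. 0)"
          using mV by (force simp: indicator_def)
        then show ?thesis by simp
      next
        case True
        \<comment> \<open>Every l > 0 with s < m l satisfies l \<le> R s, so these l form a set of
          length at most R s.\<close>
        have "(\<integral>\<^sup>+ l. indicator {l. 0 < l \<and> s < m l} l \<partial>lborel) \<le> R s"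
        proof (cases "R s")
          case (real r)
          have "l \<le> r" if "0 < l" "s < m l" for l
            using lR[of l s] em[of l] that True real by (simp add: ennreal_less_iff)
          then have "(\<integral>\<^sup>+ l. indicator {l. 0 < l \<and> s < m l} l \<partial>lborel) \<le> (\<integral>\<^sup>+ l. indicator {0..r} l \<partial>lborel)"
            by (intro nn_integral_mono) (auto simp: indicator_def)
          also have "\<dots> = R s" using real by simp
          finally show ?thesis .
        qed simp
        then have "ennreal (K s / s) * (\<integral>\<^sup>+ l. indicator {l. 0 < l \<and> s < m l} l \<partial>lborel) \<le> ennreal (K s / s) * R s"
          by (rule mult_left_mono) simp
        also have "ennreal (K s / s) * (\<integral>\<^sup>+ l. indicator {l. 0 < l \<and> s < m l} l \<partial>lborel)
          = (\<integral>\<^sup>+ l. ennreal (K s / s) * indicator {0<..<m l} s * indicator {0<..} l \<partial>lborel)"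
          using True by (subst nn_integral_cmult[symmetric]) (auto simp: indicator_def intro!: nn_integral_cong)
        finally show ?thesis using True by (simp add: mult.commute)
      qed
    qed
    finally have "(\<integral>\<^sup>+ x\<in>A. \<integral>\<^sup>+ y. ennreal (F y) * riesz_kernel \<alpha> x y \<partial>lborel \<partial>\<nu>)
      \<le> ennreal (C * a) * (4 * (\<integral>\<^sup>+ s\<in>{0<..<V}. R s * ennreal (K s / s) \<partial>lborel))"
      by (simp add: mult_left_mono)
    also have "\<dots> = ennreal (C * 4 * a) * (\<integral>\<^sup>+ s\<in>{0<..<V}. R s * ennreal (K s / s) \<partial>lborel)"
      using C t by (simp add: ennreal_mult mult.assoc mult.left_commute)
    finally show "(\<integral>\<^sup>+ x\<in>A. \<integral>\<^sup>+ y. ennreal (F y) * riesz_kernel \<alpha> x y \<partial>lborel \<partial>\<nu>)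
         \<le> ennreal (C * 4 * a) * (\<integral>\<^sup>+ s\<in>{0<..<V}. R s *
             ennreal (min (s powr (\<alpha> / ?n)) ((s / t) powr (\<alpha> / (?n - D))) / s) \<partial>lborel)"
      unfolding K_def .
  qed (use C in auto)
qed

section \<open>Rearrangement of the Riesz potential\<close>

lemma rearrangement_antimono: "s \<le> t \<Longrightarrow> rearrangement M \<Omega> g t \<le> rearrangement M \<Omega> g s"
  unfolding rearrangement_def by (intro Inf_superset_mono) (blast intro: order_trans ennreal_leI)

lemma borel_measurable_rearrangement [measurable]: "rearrangement M \<Omega> g \<in> borel_measurable borel"
proof (rule borel_measurableI_greater)
  fix y :: ennreal
  have "is_interval {x. y < rearrangement M \<Omega> g x}"
    unfolding is_interval_1 using rearrangement_antimono less_le_trans by blast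
  then show "{x \<in> space borel. y < rearrangement M \<Omega> g x} \<in> sets borel"
    by (simp add: real_interval_borel_measurable)
qed

lemma le_rearrangement:
  assumes "ennreal s < emeasure M {x \<in> \<Omega>. ereal l < \<bar>g x\<bar>}"
    and "\<And>l'. 0 < l' \<Longrightarrow> {x \<in> \<Omega>. ereal l' < \<bar>g x\<bar>} \<in> sets M"
  shows "ennreal l \<le> rearrangement M \<Omega> g s"
  unfolding rearrangement_def
proof (rule Inf_greatest, clarify)
  fix l' :: real assume l': "0 < l'" "emeasure M {x \<in> \<Omega>. ereal l' < \<bar>g x\<bar>} \<le> ennreal s"
  have "\<not> l' < l"
  proof
    assume "l' < l"
    then have "{x \<in> \<Omega>. ereal l < \<bar>g x\<bar>} \<subseteq> {x \<in> \<Omega>. ereal l' < \<bar>g x\<bar>}"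
      by (auto intro: less_trans[of "ereal l'" "ereal l"])
    then have "emeasure M {x \<in> \<Omega>. ereal l < \<bar>g x\<bar>} \<le> emeasure M {x \<in> \<Omega>. ereal l' < \<bar>g x\<bar>}"
      by (rule emeasure_mono) (rule assms(2)[OF l'(1)])
    with l' assms(1) show False by (meson leD order_trans)
  qed
  then show "ennreal l \<le> ennreal l'" by (intro ennreal_leI) simp
qed

section \<open>From the kernel to the potential\<close>

lemma riesz_gamma_pos:
  assumes "0 < \<alpha>" "\<alpha> < real n"
  shows "0 < riesz_gamma n \<alpha>"
  using assms by (simp add: riesz_gamma_def Gamma_real_pos)

text \<open>If both are infinite, the difference is \<infinity> by convention, and so is the sum.
  Points where the potential is undefined therefore need no separate treatment.\<close>

lemma abs_enn2ereal_diff_le: "\<bar>enn2ereal x - enn2ereal y\<bar> \<le> enn2ereal (x + y)"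
proof (cases x; cases y)
  fix a b :: real
  assume "0 \<le> a" "x = ennreal a" "0 \<le> b" "y = ennreal b"
  then show ?thesis by (simp add: plus_ennreal.rep_eq enn2ereal_ennreal)
qed (auto simp: plus_ennreal.rep_eq top_ennreal.rep_eq enn2ereal_ennreal)

text \<open>The Borel function \<open>h\<close> replaces f only under the Lebesgue integral in y.
  The bound therefore holds at every x, which matters because \<nu> may charge Lebesgue null
  sets.\<close>

lemma less_abs_riesz_potential:
  fixes f h :: "'a::euclidean_space \<Rightarrow> real"
  assumes \<alpha>: "0 < \<alpha>" "\<alpha> < real DIM('a)"
    and [measurable]: "h \<in> borel_measurable borel" and AE: "AE y in lborel. f y = h y"
    and l: "0 \<le> l" "ereal l < \<bar>riesz_potential \<alpha> f x\<bar>"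
  shows "ennreal (riesz_gamma DIM('a) \<alpha> * l) \<le> (\<integral>\<^sup>+ y. ennreal \<bar>h y\<bar> * riesz_kernel \<alpha> x y \<partial>lborel)"
proof -
  let ?\<Gamma> = "riesz_gamma DIM('a) \<alpha>"
  note \<Gamma> = riesz_gamma_pos[OF \<alpha>]
  have quot: "ennreal (a / norm (x - y) powr (real DIM('a) - \<alpha>)) = ennreal a * riesz_kernel \<alpha> x y" for a y
  proof -
    have "a / norm (x - y) powr (real DIM('a) - \<alpha>) = a * norm (x - y) powr - (real DIM('a) - \<alpha>)"
      unfolding powr_minus divide_inverse ..
    then show ?thesis by (simp add: riesz_kernel_def ennreal_mult'')
  qed
  define P where "P = (\<integral>\<^sup>+ y. ennreal (h y) * riesz_kernel \<alpha> x y \<partial>lborel)"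
  define N where "N = (\<integral>\<^sup>+ y. ennreal (- h y) * riesz_kernel \<alpha> x y \<partial>lborel)"
  have "riesz_potential \<alpha> f x = ereal (1 / ?\<Gamma>) * (enn2ereal P - enn2ereal N)"
  proof -
    have "(\<integral>\<^sup>+ y. ennreal (f y) * riesz_kernel \<alpha> x y \<partial>lborel) = P"
      "(\<integral>\<^sup>+ y. ennreal (- f y) * riesz_kernel \<alpha> x y \<partial>lborel) = N"
      unfolding P_def N_def using AE by (auto intro!: nn_integral_cong_AE)
    then show ?thesis
      unfolding riesz_potential_def quot nn_integral_completion by simp
  qed
  then have "\<bar>riesz_potential \<alpha> f x\<bar> = ereal (1 / ?\<Gamma>) * \<bar>enn2ereal P - enn2ereal N\<bar>"
    using \<Gamma> by (simp add: ereal_abs_mult)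
  also have "\<dots> \<le> ereal (1 / ?\<Gamma>) * enn2ereal (P + N)"
    using \<Gamma> by (intro ereal_mult_left_mono abs_enn2ereal_diff_le) auto
  finally have *: "ereal l < ereal (1 / ?\<Gamma>) * enn2ereal (P + N)"
    using l(2) by (rule less_le_trans[rotated])
  have "ennreal (?\<Gamma> * l) \<le> P + N"
  proof (cases "P + N")
    case (real r)
    then have "l < r / ?\<Gamma>" using * by (simp add: enn2ereal_ennreal)
    then have "?\<Gamma> * l \<le> r" using \<Gamma> by (simp add: field_simps)
    then show ?thesis using real by (simp add: ennreal_leI)
  qed auto
  also have "P + N = (\<integral>\<^sup>+ y. ennreal \<bar>h y\<bar> * riesz_kernel \<alpha> x y \<partial>lborel)"
  proof -
    have "ennreal (h y) * riesz_kernel \<alpha> x y + ennreal (- h y) * riesz_kernel \<alpha> x y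
        = ennreal \<bar>h y\<bar> * riesz_kernel \<alpha> x y" for y
      by (cases "0 \<le> h y") (auto simp: ennreal_neg)
    then show ?thesis
      unfolding P_def N_def by (subst nn_integral_add[symmetric]) auto
  qed
  finally show ?thesis .
qed

text \<open>If the bound failed, some l would lie strictly between its two sides. The set A where
  the potential exceeds l in absolute value then has measure a > t, and integrating over A bounds l
  a by a constant times a times the integral on the right. Cancelling a contradicts the choice of
  l.\<close>

lemma rearrangement_riesz_potential_le:
  fixes \<alpha> c D :: real and \<Omega> :: "'a::euclidean_space set"
  assumes \<alpha>: "0 < \<alpha>" "\<alpha> < real DIM('a)"
    and D: "D < real DIM('a) - \<alpha>" and c: "0 < c"
    and \<Omega>: "\<Omega> \<in> lmeasurable"
  obtains C where "0 < C"
    "\<And>\<nu> f t. sets \<nu> = sets borel \<Longrightarrow> finite_measure \<nu> \<Longrightarrow>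
       (\<And>x r. 0 < r \<Longrightarrow> emeasure \<nu> (ball x r) \<le> ennreal (c * r powr D)) \<Longrightarrow>
       f \<in> borel_measurable (lebesgue_on \<Omega>) \<Longrightarrow> 0 < t \<Longrightarrow>
       rearrangement \<nu> \<Omega> (riesz_potential \<alpha> (zero_ext \<Omega> f)) t
         \<le> ennreal C * (\<integral>\<^sup>+ s\<in>{0<..<measure lebesgue \<Omega>}. rearrangement lebesgue \<Omega> (\<lambda>x. ereal (f x)) s *
             ennreal (min (s powr (\<alpha> / real DIM('a))) ((s / t) powr (\<alpha> / (real DIM('a) - D))) / s) \<partial>lborel)"
proof -
  let ?n = "real DIM('a)"
  obtain C where C: "0 < C" and bil:
    "\<And>(\<nu>::'a measure) A F a t V (R :: real \<Rightarrow> ennreal). sets \<nu> = sets borel \<Longrightarrow> finite_measure \<nu> \<Longrightarrow>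
       (\<And>x r. 0 < r \<Longrightarrow> emeasure \<nu> (ball x r) \<le> ennreal (c * r powr D)) \<Longrightarrow>
       A \<in> sets borel \<Longrightarrow> emeasure \<nu> A = ennreal a \<Longrightarrow> 0 < t \<Longrightarrow> t \<le> a \<Longrightarrow>
       F \<in> borel_measurable borel \<Longrightarrow> (\<And>y. 0 \<le> F y) \<Longrightarrow> 0 \<le> V \<Longrightarrow>
       emeasure lborel {y. 0 < F y} \<le> ennreal V \<Longrightarrow> R \<in> borel_measurable borel \<Longrightarrow>
       (\<And>l s. 0 < l \<Longrightarrow> 0 < s \<Longrightarrow> ennreal s < emeasure lborel {y. l < F y} \<Longrightarrow> ennreal l \<le> R s) \<Longrightarrow>
       (\<integral>\<^sup>+ x\<in>A. \<integral>\<^sup>+ y. ennreal (F y) * riesz_kernel \<alpha> x y \<partial>lborel \<partial>\<nu>)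
         \<le> ennreal (C * a) * (\<integral>\<^sup>+ s\<in>{0<..<V}. R s *
             ennreal (min (s powr (\<alpha> / ?n)) ((s / t) powr (\<alpha> / (?n - D))) / s) \<partial>lborel)"
  proof (rule riesz_bilinear_rearrangement_le[OF \<alpha> D c], goal_cases)
    case (1 C)
    show ?case by (rule 1(1)[OF 1(2,3)])
  qed
  let ?\<Gamma> = "riesz_gamma DIM('a) \<alpha>"
  note \<Gamma> = riesz_gamma_pos[OF \<alpha>]
  show ?thesis
  proof (rule that[of "C / ?\<Gamma>"])
    fix \<nu> :: "'a measure" and f :: "'a \<Rightarrow> real" and t :: real
    assume \<nu>: "sets \<nu> = sets borel" "finite_measure \<nu>"
       "\<And>x r. 0 < r \<Longrightarrow> emeasure \<nu> (ball x r) \<le> ennreal (c * r powr D)"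
      and f: "f \<in> borel_measurable (lebesgue_on \<Omega>)" and t: "0 < t"
    interpret \<nu>: finite_measure \<nu> by fact
    define R where "R = rearrangement lebesgue \<Omega> (\<lambda>x. ereal (f x))"
    define W where "W = (\<integral>\<^sup>+ s\<in>{0<..<measure lebesgue \<Omega>}. R s *
             ennreal (min (s powr (\<alpha> / ?n)) ((s / t) powr (\<alpha> / (?n - D))) / s) \<partial>lborel)"
    have z: "zero_ext \<Omega> f \<in> borel_measurable lebesgue"
      unfolding zero_ext_def using \<Omega> f by (simp add: borel_measurable_if fmeasurableD)
    then obtain h where h[measurable]: "h \<in> borel_measurable lborel"
      and AE: "AE y in lborel. zero_ext \<Omega> f y = h y"
      using completion_ex_borel_measurable_real by blast
    have level: "{x \<in> \<Omega>. ereal l < \<bar>ereal (f x)\<bar>} = {x. l < \<bar>zero_ext \<Omega> f x\<bar>}" if "0 \<le> l" for l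
      using that by (auto simp: zero_ext_def)
    have level_sets: "{x \<in> \<Omega>. ereal l < \<bar>ereal (f x)\<bar>} \<in> sets lebesgue" if "0 \<le> l" for l
    proof -
      have "(\<lambda>x. \<bar>zero_ext \<Omega> f x\<bar>) -` {l<..} \<inter> space lebesgue \<in> sets lebesgue"
        by (rule measurable_sets[OF borel_measurable_abs[OF z]]) simp
      then show ?thesis unfolding level[OF that] by (simp add: vimage_def)
    qed
    \<comment> \<open>Level sets of f and h agree up to Lebesgue null sets, so the rearrangement of
      f can serve as \<open>R\<close> for |h|.\<close>
    have em: "emeasure lborel {y. l < \<bar>h y\<bar>} = emeasure lebesgue {x \<in> \<Omega>. ereal l < \<bar>ereal (f x)\<bar>}"
      if "0 \<le> l" for l
    proof -
      have "{y. l < \<bar>h y\<bar>} \<in> sets lborel" by measurable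
      then have "emeasure lborel {y. l < \<bar>h y\<bar>} = emeasure lebesgue {y. l < \<bar>h y\<bar>}"
        by simp
      also have "\<dots> = emeasure lebesgue {x \<in> \<Omega>. ereal l < \<bar>ereal (f x)\<bar>}"
      proof (rule emeasure_eq_AE)
        show "AE x in lebesgue. x \<in> {y. l < \<bar>h y\<bar>} \<longleftrightarrow> x \<in> {x \<in> \<Omega>. ereal l < \<bar>ereal (f x)\<bar>}"
          unfolding level[OF that] using AE_completion[OF AE] by eventually_elim auto
        show "{y. l < \<bar>h y\<bar>} \<in> sets lebesgue"
          using \<open>{y. l < \<bar>h y\<bar>} \<in> sets lborel\<close> by simp
      qed (rule level_sets[OF that])
      finally show ?thesis .
    qed
    show "rearrangement \<nu> \<Omega> (riesz_potential \<alpha> (zero_ext \<Omega> f)) t \<le> ennreal (C / ?\<Gamma>) * W"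
    proof (rule ccontr)
      assume "\<not> rearrangement \<nu> \<Omega> (riesz_potential \<alpha> (zero_ext \<Omega> f)) t \<le> ennreal (C / ?\<Gamma>) * W"
      then obtain z where z: "ennreal (C / ?\<Gamma>) * W < z"
        "z < rearrangement \<nu> \<Omega> (riesz_potential \<alpha> (zero_ext \<Omega> f)) t"
        using dense by (auto simp: not_le)
      then obtain l where l: "z = ennreal l" "0 \<le> l"
        by (cases z) auto
      with z(1) have l0: "0 < l" by (cases "l = 0") auto
      define A where "A = {x \<in> \<Omega>. ereal l < \<bar>riesz_potential \<alpha> (zero_ext \<Omega> f) x\<bar>}"
      have "ennreal t < emeasure \<nu> A"
      proof (rule ccontr)
        assume "\<not> ennreal t < emeasure \<nu> A"
        then have "rearrangement \<nu> \<Omega> (riesz_potential \<alpha> (zero_ext \<Omega> f)) t \<le> ennreal l"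
          unfolding rearrangement_def A_def using l0 by (intro Inf_lower) auto
        with z l show False by simp
      qed
      \<comment> \<open>A set outside \<open>sets \<nu>\<close> has \<open>emeasure\<close> 0, so
        the strict inequality just proved already makes the level set measurable.\<close>
      moreover then have A: "A \<in> sets \<nu>"
        using emeasure_notin_sets[of A \<nu>] by (cases "A \<in> sets \<nu>") auto
      moreover define a where "a = measure \<nu> A"
      ultimately have a: "emeasure \<nu> A = ennreal a" "t < a"
        using t by (auto simp: \<nu>.emeasure_eq_measure ennreal_less_iff)
      have [measurable]: "A \<in> sets borel" using A \<nu> by simp
      have "ennreal (?\<Gamma> * l) * emeasure \<nu> A = (\<integral>\<^sup>+ x. ennreal (?\<Gamma> * l) * indicator A x \<partial>\<nu>)"
        by (rule nn_integral_cmult_indicator[OF A, symmetric])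
      also have "\<dots> \<le> (\<integral>\<^sup>+ x\<in>A. \<integral>\<^sup>+ y. ennreal \<bar>h y\<bar> * riesz_kernel \<alpha> x y \<partial>lborel \<partial>\<nu>)"
      proof (rule nn_integral_mono)
        fix x
        show "ennreal (?\<Gamma> * l) * indicator A x
          \<le> (\<integral>\<^sup>+ y. ennreal \<bar>h y\<bar> * riesz_kernel \<alpha> x y \<partial>lborel) * indicator A x"
          using less_abs_riesz_potential[OF \<alpha> _ AE, of l x] h l0
          by (auto simp: indicator_def A_def)
      qed
      also have "\<dots> \<le> ennreal (C * a) * W"
        unfolding W_def
      proof (rule bil)
        show "emeasure lborel {y. 0 < \<bar>h y\<bar>} \<le> ennreal (measure lebesgue \<Omega>)"
          unfolding em[OF order_refl] emeasure_eq_measure2[OF \<Omega>, symmetric]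
          by (rule emeasure_mono[OF _ fmeasurableD[OF \<Omega>]]) auto
        show "R \<in> borel_measurable borel" unfolding R_def by measurable
        fix l s :: real assume "0 < l" "ennreal s < emeasure lborel {y. l < \<bar>h y\<bar>}"
        then show "ennreal l \<le> R s"
          unfolding R_def by (intro le_rearrangement level_sets) (auto simp: em)
      qed (use \<nu> a t in auto)
      finally have *: "ennreal (?\<Gamma> * l) * ennreal a \<le> ennreal (C * a) * W"
        unfolding a .
      have "W \<noteq> top" using z(1) C \<Gamma> by (auto simp: ennreal_mult_top)
      then obtain w where w: "W = ennreal w" "0 \<le> w" by (cases W) auto
      from * have "?\<Gamma> * l * a \<le> C * a * w"
        using w C a t \<Gamma> l by (simp flip: ennreal_mult)
      then have "l \<le> C / ?\<Gamma> * w"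
        using a t \<Gamma> by (simp add: field_simps)
      then have "ennreal l \<le> ennreal (C / ?\<Gamma>) * W"
        using w C \<Gamma> by (simp add: ennreal_leI flip: ennreal_mult)
      with z(1) l show False by simp
    qed
  qed (use C \<Gamma> in auto)
qed

section \<open>Hardy inequalities\<close>

lemma nn_integral_le_antiderivative:
  fixes f F :: "real \<Rightarrow> real"
  assumes [measurable]: "f \<in> borel_measurable borel"
    and deriv: "\<And>x. 0 < x \<Longrightarrow> x \<le> T \<Longrightarrow> (F has_real_derivative f x) (at x)"
    and f: "\<And>x. 0 < x \<Longrightarrow> x \<le> T \<Longrightarrow> 0 \<le> f x" and F: "\<And>x. 0 < x \<Longrightarrow> x \<le> T \<Longrightarrow> 0 \<le> F x"
  shows "(\<integral>\<^sup>+ x\<in>{0<..T}. ennreal (f x) \<partial>lborel) \<le> ennreal (F T)"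
proof -
  let ?I = "\<lambda>n x. ennreal (f x) * indicator {1 / real (Suc n)..T} x"
  have SUP: "(SUP n. ?I n x) = ennreal (f x) * indicator {0<..T} x" for x
  proof (cases "0 < x \<and> x \<le> T")
    case True
    then obtain n where "1 / real (Suc n) < x"
      using nat_approx_posE by blast
    then have "ennreal (f x) * indicator {0<..T} x = ?I n x"
      using True by simp
    also have "\<dots> \<le> (SUP n. ?I n x)"
      by (rule SUP_upper) simp
    finally have "ennreal (f x) * indicator {0<..T} x \<le> (SUP n. ?I n x)" .
    moreover have "(SUP n. ?I n x) \<le> ennreal (f x) * indicator {0<..T} x"
      by (intro SUP_least) (auto simp: indicator_def True)
    ultimately show ?thesis by (rule antisym[OF _ _, rotated])
  next
    case False
    then have "?I n x = 0" for n
      using less_le_trans[of 0 "1 / real (Suc n)" x] by (auto simp: indicator_def simp del: of_nat_Suc)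
    then have "(SUP n. ?I n x) = 0" by (simp only: SUP_const) simp
    with False show ?thesis by simp
  qed
  have "incseq ?I"
  proof (intro incseq_SucI le_funI mult_left_mono)
    fix n :: nat and x :: real
    have "1 / real (Suc (Suc n)) \<le> 1 / real (Suc n)"
      by (intro divide_left_mono) auto
    then show "(indicator {1 / real (Suc n)..T} x :: ennreal) \<le> indicator {1 / real (Suc (Suc n))..T} x"
      by (auto simp: indicator_def simp del: of_nat_Suc)
  qed simp
  then have "(\<integral>\<^sup>+ x\<in>{0<..T}. ennreal (f x) \<partial>lborel) = (SUP n. integral\<^sup>N lborel (?I n))"
    unfolding SUP[symmetric] by (rule nn_integral_monotone_convergence_SUP) measurable
  also have "\<dots> \<le> ennreal (F T)"
  proof (rule SUP_least)
    fix n :: nat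
    have n: "0 < 1 / real (Suc n)" by simp
    show "integral\<^sup>N lborel (?I n) \<le> ennreal (F T)"
    proof (cases "1 / real (Suc n) \<le> T")
      case True
      have "0 < x" if "1 / real (Suc n) \<le> x" for x
        using n that by linarith
      then have "integral\<^sup>N lborel (?I n) = ennreal (F T - F (1 / real (Suc n)))"
        using True by (intro nn_integral_FTC_Icc) (auto intro!: deriv f simp del: of_nat_Suc)
      also have "\<dots> \<le> ennreal (F T)"
        using F[OF n True] by (intro ennreal_leI) simp
      finally show ?thesis .
    qed (simp del: of_nat_Suc)
  qed
  finally show ?thesis .
qed

section \<open>Schur's test and its two applications\<close>

text \<open>Jensen in u for the measure with density \<open>k t\<close>, of mass at most
  \<open>M t\<close>, costs the factor M t^(q-1). Tonelli then leaves the column integral bounded by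
  \<open>N u\<close>. The usual auxiliary weight is absent: where one is wanted, it is divided out
  of \<open>k\<close> and multiplied into \<open>G\<close> beforehand.\<close>

lemma nn_integral_Schur:
  fixes G :: "'b \<Rightarrow> ennreal" and k :: "'a \<Rightarrow> 'b \<Rightarrow> ennreal" and M :: "'a \<Rightarrow> real"
  assumes "sigma_finite_measure P" "sigma_finite_measure Q"
    and [measurable]: "G \<in> borel_measurable Q" "case_prod k \<in> borel_measurable (P \<Otimes>\<^sub>M Q)"
      "M \<in> borel_measurable P" "w \<in> borel_measurable P"
    and q: "1 < q"
    and M: "\<And>t. t \<in> space P \<Longrightarrow> w t \<noteq> 0 \<Longrightarrow> 0 < M t \<and> (\<integral>\<^sup>+ u. k t u \<partial>Q) \<le> ennreal (M t)"
    and N: "\<And>u. u \<in> space Q \<Longrightarrow> (\<integral>\<^sup>+ t. w t * ennreal (M t powr (q - 1)) * k t u \<partial>P) \<le> N u"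
  shows "(\<integral>\<^sup>+ t. w t * ennreal_powr (\<integral>\<^sup>+ u. G u * k t u \<partial>Q) q \<partial>P)
    \<le> (\<integral>\<^sup>+ u. ennreal_powr (G u) q * N u \<partial>Q)"
proof -
  interpret P: sigma_finite_measure P by fact
  interpret Q: sigma_finite_measure Q by fact
  interpret pair_sigma_finite P Q ..
  have "(\<integral>\<^sup>+ t. w t * ennreal_powr (\<integral>\<^sup>+ u. G u * k t u \<partial>Q) q \<partial>P)
    \<le> (\<integral>\<^sup>+ t. \<integral>\<^sup>+ u. ennreal_powr (G u) q * (w t * ennreal (M t powr (q - 1)) * k t u) \<partial>Q \<partial>P)"
  proof (rule nn_integral_mono)
    fix t assume t: "t \<in> space P"
    have [measurable]: "k t \<in> borel_measurable Q"
      using measurable_Pair2[OF assms(4) t] by simp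
    show "w t * ennreal_powr (\<integral>\<^sup>+ u. G u * k t u \<partial>Q) q
      \<le> (\<integral>\<^sup>+ u. ennreal_powr (G u) q * (w t * ennreal (M t powr (q - 1)) * k t u) \<partial>Q)"
    proof (cases "w t = 0")
      case False
      have "w t * ennreal_powr (\<integral>\<^sup>+ u. G u * k t u \<partial>Q) q
        \<le> w t * (ennreal (M t powr (q - 1)) * (\<integral>\<^sup>+ u. ennreal_powr (G u) q * k t u \<partial>Q))"
        using M[OF t False] q by (intro mult_left_mono nn_integral_powr_Jensen) auto
      also have "\<dots> = (\<integral>\<^sup>+ u. w t * ennreal (M t powr (q - 1)) * (ennreal_powr (G u) q * k t u) \<partial>Q)"
        by (subst nn_integral_cmult) (auto simp: mult.assoc)
      finally show ?thesis by (simp add: ac_simps)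
    qed simp
  qed
  also have "\<dots> = (\<integral>\<^sup>+ u. \<integral>\<^sup>+ t. ennreal_powr (G u) q * (w t * ennreal (M t powr (q - 1)) * k t u) \<partial>P \<partial>Q)"
    by (rule Fubini'[symmetric]) measurable
  also have "\<dots> \<le> (\<integral>\<^sup>+ u. ennreal_powr (G u) q * N u \<partial>Q)"
  proof (rule nn_integral_mono)
    fix u assume u: "u \<in> space Q"
    have [measurable]: "(\<lambda>t. k t u) \<in> borel_measurable P"
      using measurable_Pair1[OF assms(4) u] by simp
    have "(\<integral>\<^sup>+ t. ennreal_powr (G u) q * (w t * ennreal (M t powr (q - 1)) * k t u) \<partial>P)
      = ennreal_powr (G u) q * (\<integral>\<^sup>+ t. w t * ennreal (M t powr (q - 1)) * k t u \<partial>P)"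
      by (rule nn_integral_cmult) measurable
    also have "\<dots> \<le> ennreal_powr (G u) q * N u"
      by (intro mult_left_mono N u) simp
    finally show "(\<integral>\<^sup>+ t. ennreal_powr (G u) q * (w t * ennreal (M t powr (q - 1)) * k t u) \<partial>P)
      \<le> ennreal_powr (G u) q * N u" .
  qed
  finally show ?thesis .
qed

text \<open>The kernel is scale invariant, so constant bounds suffice in Schur's test. Integrating
  in du/u up to the point where u^\<epsilon> = t^\<delta> gives 1/\<epsilon>; integrating in dt/t
  from that point on gives 1/\<delta>.\<close>

lemma Hardy_local:
  fixes g :: "real \<Rightarrow> ennreal" and \<delta> \<epsilon> q V :: real
  assumes [measurable]: "g \<in> borel_measurable borel" and pos: "0 < \<delta>" "0 < \<epsilon>" "1 < q"
  shows "(\<integral>\<^sup>+ t\<in>{0<..}. ennreal_powr (\<integral>\<^sup>+ u. g u * (ennreal (u powr \<epsilon> * t powr - \<delta> / u)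
        * indicator {u. 0 < u \<and> u < V \<and> u powr \<epsilon> \<le> t powr \<delta>} u) \<partial>lborel) q * ennreal (1 / t) \<partial>lborel)
    \<le> ennreal ((1 / \<epsilon>) powr (q - 1) / \<delta>) * (\<integral>\<^sup>+ u\<in>{0<..<V}. ennreal_powr (g u) q * ennreal (1 / u) \<partial>lborel)"
proof -
  define k where "k t u = ennreal (u powr \<epsilon> * t powr - \<delta> / u)
      * indicator {u. 0 < u \<and> u < V \<and> u powr \<epsilon> \<le> t powr \<delta>} u" for t u :: real
  have [measurable]: "case_prod k \<in> borel_measurable (borel \<Otimes>\<^sub>M borel)"
    unfolding k_def by measurable
  have "(\<integral>\<^sup>+ t. ennreal (1 / t) * indicator {0<..} t * ennreal_powr (\<integral>\<^sup>+ u. g u * k t u \<partial>lborel) q \<partial>lborel)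
    \<le> (\<integral>\<^sup>+ u. ennreal_powr (g u) q * (ennreal ((1 / \<epsilon>) powr (q - 1) / \<delta>) * (ennreal (1 / u) * indicator {0<..<V} u)) \<partial>lborel)"
  proof (rule nn_integral_Schur[where M = "\<lambda>_. 1 / \<epsilon>"])
    fix t :: real assume "ennreal (1 / t) * indicator {0<..} t \<noteq> 0"
    then have t: "0 < t" by (auto simp: indicator_def split: if_splits)
    define T where "T = t powr (\<delta> / \<epsilon>)"
    have T: "0 < T" "T powr \<epsilon> = t powr \<delta>"
      using t pos by (auto simp: T_def powr_powr)
    have "(\<integral>\<^sup>+ u. k t u \<partial>lborel) \<le> (\<integral>\<^sup>+ u\<in>{0<..T}. ennreal (t powr - \<delta> * u powr (\<epsilon> - 1)) \<partial>lborel)"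
    proof (rule nn_integral_mono)
      fix u :: real
      have "u \<le> T" if "0 < u" "u powr \<epsilon> \<le> T powr \<epsilon>"
        using that T pos powr_less_mono2[of \<epsilon> T u] by (cases "u \<le> T") auto
      then show "k t u \<le> ennreal (t powr - \<delta> * u powr (\<epsilon> - 1)) * indicator {0<..T} u"
        using T by (auto simp: k_def indicator_def powr_diff mult.commute)
    qed
    also have "\<dots> \<le> ennreal (t powr - \<delta> * (T powr \<epsilon> / \<epsilon>))"
      using pos by (intro nn_integral_le_antiderivative) (auto intro!: derivative_eq_intros)
    also have "\<dots> = ennreal (1 / \<epsilon>)"
      using t T by (simp add: powr_minus)
    finally show "0 < 1 / \<epsilon> \<and> (\<integral>\<^sup>+ u. k t u \<partial>lborel) \<le> ennreal (1 / \<epsilon>)"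
      using pos by simp
  next
    fix u :: real
    show "(\<integral>\<^sup>+ t. ennreal (1 / t) * indicator {0<..} t * ennreal ((1 / \<epsilon>) powr (q - 1)) * k t u \<partial>lborel)
      \<le> ennreal ((1 / \<epsilon>) powr (q - 1) / \<delta>) * (ennreal (1 / u) * indicator {0<..<V} u)"
    proof (cases "0 < u \<and> u < V")
      case False
      then have "k t u = 0" for t by (auto simp: k_def indicator_def)
      then show ?thesis by simp
    next
      case True
      define T where "T = u powr (\<epsilon> / \<delta>)"
      have T: "0 < T" "T powr \<delta> = u powr \<epsilon>"
        using True pos by (auto simp: T_def powr_powr)
      let ?c = "(1 / \<epsilon>) powr (q - 1) * (u powr \<epsilon> / u)"
      have "(\<integral>\<^sup>+ t. ennreal (1 / t) * indicator {0<..} t * ennreal ((1 / \<epsilon>) powr (q - 1)) * k t u \<partial>lborel)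
        \<le> (\<integral>\<^sup>+ t\<in>{T..}. ennreal (?c * t powr (- \<delta> - 1)) \<partial>lborel)"
      proof (rule nn_integral_mono)
        fix t :: real
        have "T \<le> t" if "0 < t" "T powr \<delta> \<le> t powr \<delta>"
          using that T pos powr_less_mono2[of \<delta> t T] by (cases "T \<le> t") auto
        then show "ennreal (1 / t) * indicator {0<..} t * ennreal ((1 / \<epsilon>) powr (q - 1)) * k t u
          \<le> ennreal (?c * t powr (- \<delta> - 1)) * indicator {T..} t"
          using T True by (auto simp: k_def indicator_def powr_diff ac_simps simp flip: ennreal_mult)
      qed
      also have "\<dots> = ennreal (0 - ?c * (- (T powr - \<delta> / \<delta>)))"
      proof (rule nn_integral_FTC_atLeast)
        show "((\<lambda>t. ?c * (- (t powr - \<delta> / \<delta>))) has_real_derivative ?c * x powr (- \<delta> - 1)) (at x)"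
          if "T \<le> x" for x
          using that T pos by (auto intro!: derivative_eq_intros simp: field_simps)
        have "((\<lambda>t. t powr - \<delta>) \<longlongrightarrow> 0) at_top"
          using pos by (intro tendsto_neg_powr filterlim_ident) auto
        then have "((\<lambda>t. ?c * (- (t powr - \<delta> / \<delta>))) \<longlongrightarrow> ?c * (- (0 / \<delta>))) at_top"
          by (intro tendsto_intros) (use pos in auto)
        then show "((\<lambda>t. ?c * (- (t powr - \<delta> / \<delta>))) \<longlongrightarrow> 0) at_top"
          by simp
      qed (use True in auto)
      also have "0 - ?c * (- (T powr - \<delta> / \<delta>)) = (1 / \<epsilon>) powr (q - 1) / \<delta> * (1 / u)"
        using T True by (simp add: powr_minus divide_simps)
      also have "ennreal \<dots> = ennreal ((1 / \<epsilon>) powr (q - 1) / \<delta>) * ennreal (1 / u)"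
        using True pos by (intro ennreal_mult) auto
      finally show ?thesis
        using True by simp
    qed
  qed (use pos in \<open>auto intro: lborel.sigma_finite_measure_axioms\<close>)
  also have "\<dots> = ennreal ((1 / \<epsilon>) powr (q - 1) / \<delta>) *
      (\<integral>\<^sup>+ u\<in>{0<..<V}. ennreal_powr (g u) q * ennreal (1 / u) \<partial>lborel)"
    by (subst nn_integral_cmult[symmetric]) (auto simp: ac_simps intro!: nn_integral_cong)
  finally show ?thesis
    unfolding k_def by (simp add: ac_simps)
qed

text \<open>The last hypothesis gives ln u \<ge> (\<delta>/\<epsilon>) ln t. Hence the logarithmic
  distance from u to V is at most \<delta>/\<epsilon> times that from t to m, plus the cost of
  recentring at V and m. The terms with ln V and ln m in the factor are this cost.\<close>

lemma log_scale_comparison: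
  fixes \<delta> \<epsilon> m V t u :: real
  assumes "0 < \<delta>" "0 < \<epsilon>" "0 < u" "0 < t" "t \<le> m" "t powr \<delta> \<le> u powr \<epsilon>"
  shows "1 + ln V - ln u \<le> (1 + \<bar>ln V\<bar> + \<delta> / \<epsilon> * \<bar>ln m\<bar> + \<delta> / \<epsilon>) * (1 + ln m - ln t)"
proof -
  let ?c = "1 + \<bar>ln V\<bar> + \<delta> / \<epsilon> * \<bar>ln m\<bar>" and ?x = "ln m - ln t"
  have x: "0 \<le> ?x" using assms by simp
  have "\<delta> * ln t \<le> \<epsilon> * ln u"
    using assms ln_mono[of "t powr \<delta>" "u powr \<epsilon>"] by (simp add: ln_powr)
  then have "\<delta> / \<epsilon> * ln t \<le> ln u"
    using assms by (simp add: field_simps)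
  then have "1 + ln V - ln u \<le> 1 + ln V - \<delta> / \<epsilon> * ln m + \<delta> / \<epsilon> * ?x"
    by (simp add: algebra_simps)
  also have "- (\<delta> / \<epsilon> * ln m) \<le> \<delta> / \<epsilon> * \<bar>ln m\<bar>"
    using assms mult_left_mono[of "- ln m" "\<bar>ln m\<bar>" "\<delta> / \<epsilon>"] by simp
  then have "1 + ln V - \<delta> / \<epsilon> * ln m + \<delta> / \<epsilon> * ?x \<le> ?c + \<delta> / \<epsilon> * ?x"
    by simp
  also have "\<dots> \<le> (?c + \<delta> / \<epsilon>) * (1 + ?x)"
  proof -
    have "0 \<le> ?c * ?x" "0 \<le> \<delta> / \<epsilon>" using x assms by auto
    then show ?thesis by (simp add: distrib_left distrib_right)
  qed
  finally show ?thesis by (simp add: algebra_simps)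
qed

text \<open>In the variables x = 1 + ln m - ln t and y = 1 + ln V - ln u, the measures dt/t and du/u
  become dx and dy. By \<open>log_scale_comparison\<close> the kernel lives on y \<le> c x, so the
  operator is dominated by the average of G over 1 < y < c x, up to the factor c: the classical
  Hardy inequality on L^q. The added 1 keeps both variables away from 0.\<close>

lemma Hardy_log:
  fixes \<delta> \<epsilon> q V m :: real
  assumes pos: "0 < \<delta>" "0 < \<epsilon>" "1 < q" "0 < m" "0 < V"
  obtains C where "0 < C" "\<And>g. g \<in> borel_measurable borel \<Longrightarrow>
    (\<integral>\<^sup>+ t\<in>{0<..<m}. ennreal_powr (\<integral>\<^sup>+ u. g u * (ennreal (1 / u)
        * indicator {u. 0 < u \<and> u < V \<and> t powr \<delta> < u powr \<epsilon>} u) \<partial>lborel) q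
          * ennreal ((1 + ln m - ln t) powr - q / t) \<partial>lborel)
    \<le> ennreal C * (\<integral>\<^sup>+ u\<in>{0<..<V}. ennreal_powr (g u) q * ennreal (1 / u) \<partial>lborel)"
proof -
  define \<eta> where "\<eta> = 1 - 1 / q"
  have \<eta>: "0 < \<eta>" using pos by (simp add: \<eta>_def)
  define c where "c = 1 + \<bar>ln V\<bar> + \<delta> / \<epsilon> * \<bar>ln m\<bar> + \<delta> / \<epsilon>"
  have c: "0 < c" using pos by (auto simp: c_def intro!: add_pos_nonneg)
  define \<phi> where "\<phi> u = 1 + ln V - ln u" for u
  define \<psi> where "\<psi> t = 1 + ln m - ln t" for t
  have [measurable]: "\<phi> \<in> borel_measurable borel" "\<psi> \<in> borel_measurable borel"
    unfolding \<phi>_def \<psi>_def by measurable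
  have \<phi>: "1 \<le> \<phi> u" if "0 < u" "u \<le> V" for u using that pos by (simp add: \<phi>_def)
  have \<psi>: "1 \<le> \<psi> t" if "0 < t" "t \<le> m" for t using that pos by (simp add: \<psi>_def)
  have compare: "\<phi> u \<le> c * \<psi> t" if "0 < u" "0 < t" "t \<le> m" "t powr \<delta> \<le> u powr \<epsilon>" for u t
    unfolding \<phi>_def \<psi>_def c_def using pos that by (intro log_scale_comparison)
  \<comment> \<open>The constant of the row integrals, which grow like \<psi>^\<eta>. The column
    integrals reproduce the same constant, which is why A^(q-1) A appears in
    \<open>N\<close>.\<close>
  define A where "A = c powr \<eta> / \<eta>"
  have A: "0 < A" using c \<eta> by (simp add: A_def)
  \<comment> \<open>Schur's test with the weight \<open>\<phi> u powr (1 / q)\<close>, which is moved from the kernel to the function.\<close>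
  define k where "k t u = ennreal (\<phi> u powr (- 1 / q) / u)
      * indicator {u. 0 < u \<and> u < V \<and> t powr \<delta> < u powr \<epsilon>} u" for t u :: real
  have [measurable]: "case_prod k \<in> borel_measurable (borel \<Otimes>\<^sub>M borel)"
    unfolding k_def by measurable
  define w where "w t = ennreal (\<psi> t powr - q / t) * indicator {0<..<m} t" for t
  have [measurable]: "w \<in> borel_measurable borel"
    unfolding w_def by measurable
  define M where "M t = A * \<psi> t powr \<eta>" for t
  have [measurable]: "M \<in> borel_measurable borel"
    unfolding M_def by measurable
  define N where "N u = ennreal (A powr (q - 1) * A) * (ennreal (1 / (\<phi> u * u)) * indicator {0<..<V} u)" for u
  have kM: "(\<integral>\<^sup>+ u. k t u \<partial>lborel) \<le> ennreal (M t)" if t: "0 < t" "t < m" for t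
  proof -
    define s where "s = t powr (\<delta> / \<epsilon>)"
    have s: "0 < s" "s powr \<epsilon> = t powr \<delta>"
      using t pos by (auto simp: s_def powr_powr)
    have su: "s < u" if "0 < u" "s powr \<epsilon> < u powr \<epsilon>" for u
      using that s pos powr_mono2[of \<epsilon> u s] by (cases "s < u") auto
    show ?thesis
    proof (cases "s \<le> V")
      case False
      then have "k t u = 0" for u
        using s su[of u] by (auto simp: k_def indicator_def)
      then show ?thesis by simp
    next
      case True
      have "(\<integral>\<^sup>+ u. k t u \<partial>lborel) \<le> (\<integral>\<^sup>+ u\<in>{s..V}. ennreal (\<phi> u powr (\<eta> - 1) / u) \<partial>lborel)"
        using s by (intro nn_integral_mono) (auto simp: k_def indicator_def \<eta>_def dest!: su)
      also have "\<dots> = ennreal (- (\<phi> V powr \<eta> / \<eta>) - - (\<phi> s powr \<eta> / \<eta>))"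
      proof (rule nn_integral_FTC_Icc)
        fix u assume u: "u \<in> {s..V}"
        then have "0 < u" "0 < \<phi> u" using s \<phi>[of u] by auto
        moreover from this have "(\<phi> has_real_derivative - 1 / u) (at u)"
          unfolding \<phi>_def by (auto intro!: derivative_eq_intros)
        ultimately show "((\<lambda>u. - (\<phi> u powr \<eta> / \<eta>)) has_real_derivative \<phi> u powr (\<eta> - 1) / u) (at u)"
          using \<eta> by (auto intro!: derivative_eq_intros simp: powr_diff field_simps)
        show "0 \<le> \<phi> u powr (\<eta> - 1) / u" using \<open>0 < u\<close> by simp
      qed (use True in auto)
      also have "\<dots> \<le> ennreal (\<phi> s powr \<eta> / \<eta>)"
        using \<eta> by (intro ennreal_leI) simp
      also have "\<dots> \<le> ennreal ((c * \<psi> t) powr \<eta> / \<eta>)"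
        using \<eta> t s \<phi>[of s] True
        by (intro ennreal_leI divide_right_mono powr_mono2 compare) auto
      also have "(c * \<psi> t) powr \<eta> / \<eta> = M t"
        using c \<psi>[of t] t by (simp add: M_def A_def powr_mult)
      finally show ?thesis .
    qed
  qed
  have kN: "(\<integral>\<^sup>+ t. w t * ennreal (M t powr (q - 1)) * k t u \<partial>lborel) \<le> N u" for u
  proof (cases "0 < u \<and> u < V")
    case False
    then have "k t u = 0" for t by (auto simp: k_def indicator_def)
    then show ?thesis by simp
  next
    case True
    \<comment> \<open>The t-range for a given u ends at most here. As \<psi> decreases, its smallest
      value on (0, T] is \<psi> T, which \<open>compare\<close> bounds below by \<phi> u /
      c.\<close>
    define T where "T = min m (u powr (\<epsilon> / \<delta>))"
    have T: "0 < T" "T \<le> m" "T powr \<delta> \<le> u powr \<epsilon>"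
    proof -
      have "T powr \<delta> \<le> (u powr (\<epsilon> / \<delta>)) powr \<delta>"
        using pos True by (intro powr_mono2) (auto simp: T_def)
      then show "T powr \<delta> \<le> u powr \<epsilon>"
        using pos by (simp add: powr_powr)
    qed (use True pos in \<open>auto simp: T_def\<close>)
    let ?b = "A powr (q - 1) * (\<phi> u powr (- 1 / q) / u)"
    have "(\<integral>\<^sup>+ t. w t * ennreal (M t powr (q - 1)) * k t u \<partial>lborel)
      \<le> (\<integral>\<^sup>+ t\<in>{0<..T}. ennreal (?b * (\<psi> t powr (- 1 - \<eta>) / t)) \<partial>lborel)"
    proof (rule nn_integral_mono)
      fix t :: real
      show "w t * ennreal (M t powr (q - 1)) * k t u
        \<le> ennreal (?b * (\<psi> t powr (- 1 - \<eta>) / t)) * indicator {0<..T} t"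
      proof (cases "0 < t \<and> t < m \<and> t powr \<delta> < u powr \<epsilon>")
        case False
        then show ?thesis by (auto simp: w_def k_def indicator_def)
      next
        case t: True
        have "t \<le> u powr (\<epsilon> / \<delta>)"
        proof (rule ccontr)
          assume "\<not> t \<le> u powr (\<epsilon> / \<delta>)"
          then have "(u powr (\<epsilon> / \<delta>)) powr \<delta> < t powr \<delta>"
            using pos by (intro powr_less_mono2) auto
          with t pos show False by (simp add: powr_powr)
        qed
        then have tT: "t \<in> {0<..T}" using t by (auto simp: T_def)
        \<comment> \<open>The weight \<psi>^(-q) times the Schur factor M^(q-1) leaves an exponent
          below -1, so the integral converges as t tends to 0, that is, as \<psi> tends to
          infinity.\<close>
        have "- q + \<eta> * (q - 1) = - 1 - \<eta>"
          using pos by (simp add: \<eta>_def field_simps)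
        then have "\<psi> t powr - q * M t powr (q - 1) = A powr (q - 1) * \<psi> t powr (- 1 - \<eta>)"
          using A \<psi>[of t] t by (simp add: M_def powr_mult powr_powr mult.left_commute flip: powr_add)
        then have "\<psi> t powr - q / t * M t powr (q - 1) * (\<phi> u powr (- 1 / q) / u) = ?b * (\<psi> t powr (- 1 - \<eta>) / t)"
          by (simp add: field_simps)
        then show ?thesis
          using t tT True by (simp add: w_def k_def flip: ennreal_mult)
      qed
    qed
    also have "\<dots> \<le> ennreal (?b * (\<psi> T powr - \<eta> / \<eta>))"
    proof (rule nn_integral_le_antiderivative)
      fix t assume t: "0 < t" "t \<le> T"
      then have p: "0 < \<psi> t" using T \<psi>[of t] by simp
      have "(\<psi> has_real_derivative - 1 / t) (at t)"
        using t unfolding \<psi>_def by (auto intro!: derivative_eq_intros)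
      then have "((\<lambda>t. \<psi> t powr - \<eta> / \<eta>) has_real_derivative \<psi> t powr (- 1 - \<eta>) / t) (at t)"
        using \<eta> t p by (auto intro!: derivative_eq_intros simp: powr_diff powr_minus field_simps)
      then show "((\<lambda>t. ?b * (\<psi> t powr - \<eta> / \<eta>)) has_real_derivative ?b * (\<psi> t powr (- 1 - \<eta>) / t)) (at t)"
        by (rule DERIV_cmult)
      show "0 \<le> ?b * (\<psi> t powr (- 1 - \<eta>) / t)" "0 \<le> ?b * (\<psi> t powr - \<eta> / \<eta>)"
        using True t \<eta> by auto
    qed measurable
    also have "\<dots> \<le> ennreal (?b * (c powr \<eta> * \<phi> u powr - \<eta> / \<eta>))"
    proof (intro ennreal_leI mult_left_mono divide_right_mono)
      have "\<phi> u / c \<le> \<psi> T"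
        using compare[of u T] True T c by (simp add: field_simps)
      then have "\<psi> T powr - \<eta> \<le> (\<phi> u / c) powr - \<eta>"
        using \<eta> c \<phi>[of u] True by (intro powr_mono2') auto
      also have "\<dots> = c powr \<eta> * \<phi> u powr - \<eta>"
        using c \<phi>[of u] True by (simp add: powr_divide powr_minus field_simps)
      finally show "\<psi> T powr - \<eta> \<le> c powr \<eta> * \<phi> u powr - \<eta>" .
    qed (use \<eta> True in auto)
    also have "?b * (c powr \<eta> * \<phi> u powr - \<eta> / \<eta>) = A powr (q - 1) * A * (1 / (\<phi> u * u))"
    proof -
      have "\<phi> u powr (- 1 / q) * \<phi> u powr - \<eta> = \<phi> u powr - 1"
        unfolding powr_add[symmetric] by (simp add: \<eta>_def)
      also have "\<dots> = 1 / \<phi> u"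
        using \<phi>[of u] True by (simp add: powr_minus divide_inverse)
      finally have "\<phi> u powr (- 1 / q) * \<phi> u powr - \<eta> = 1 / \<phi> u" .
      then have "A powr (q - 1) * A * (1 / (\<phi> u * u))
          = A powr (q - 1) * A * (\<phi> u powr (- 1 / q) * \<phi> u powr - \<eta> / u)"
        by simp
      also have "a * A * (x * y / u) = a * (x / u) * (c powr \<eta> * y / \<eta>)" for a x y
        by (simp add: A_def ac_simps)
      finally show ?thesis by simp
    qed
    also have "ennreal \<dots> = N u"
      unfolding N_def using A True by (subst ennreal_mult) (use \<phi>[of u] in auto)
    finally show ?thesis .
  qed
  show ?thesis
  proof (rule that[of "A powr (q - 1) * A"])
    fix g :: "real \<Rightarrow> ennreal" assume [measurable]: "g \<in> borel_measurable borel"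
    have "(\<integral>\<^sup>+ t\<in>{0<..<m}. ennreal_powr (\<integral>\<^sup>+ u. g u * (ennreal (1 / u)
        * indicator {u. 0 < u \<and> u < V \<and> t powr \<delta> < u powr \<epsilon>} u) \<partial>lborel) q
          * ennreal ((1 + ln m - ln t) powr - q / t) \<partial>lborel)
      = (\<integral>\<^sup>+ t. w t * ennreal_powr (\<integral>\<^sup>+ u. g u * ennreal (\<phi> u powr (1 / q)) * k t u \<partial>lborel) q \<partial>lborel)"
    proof -
      have "g u * ennreal (\<phi> u powr (1 / q)) * k t u
         = g u * (ennreal (1 / u) * indicator {u. 0 < u \<and> u < V \<and> t powr \<delta> < u powr \<epsilon>} u)" for t u
      proof (cases "0 < u \<and> u < V")
        case True
        then have "\<phi> u powr (1 / q) * (\<phi> u powr (- 1 / q) / u) = 1 / u"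
          using \<phi>[of u] by (simp add: powr_minus divide_simps)
        then show ?thesis
          using True by (simp add: k_def mult.assoc[symmetric])
             (simp add: mult.assoc flip: ennreal_mult)
      qed (auto simp: k_def indicator_def)
      then show ?thesis
        by (simp add: w_def \<psi>_def ac_simps)
    qed
    also have "\<dots> \<le> (\<integral>\<^sup>+ u. ennreal_powr (g u * ennreal (\<phi> u powr (1 / q))) q * N u \<partial>lborel)"
    proof (rule nn_integral_Schur[where M = M])
      fix t assume "w t \<noteq> 0"
      then have t: "0 < t" "t < m" by (auto simp: w_def indicator_def split: if_splits)
      then show "0 < M t \<and> (\<integral>\<^sup>+ u. k t u \<partial>lborel) \<le> ennreal (M t)"
        using kM[OF t] A \<psi>[of t] by (simp add: M_def)
    qed (use pos kN in \<open>auto intro: lborel.sigma_finite_measure_axioms\<close>)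
    also have "\<dots> = (\<integral>\<^sup>+ u. ennreal (A powr (q - 1) * A) *
        (ennreal_powr (g u) q * ennreal (1 / u) * indicator {0<..<V} u) \<partial>lborel)"
    proof (rule nn_integral_cong)
      fix u
      show "ennreal_powr (g u * ennreal (\<phi> u powr (1 / q))) q * N u = ennreal (A powr (q - 1) * A) *
        (ennreal_powr (g u) q * ennreal (1 / u) * indicator {0<..<V} u)"
      proof (cases "0 < u \<and> u < V")
        case True
        then have p: "0 < \<phi> u" using \<phi>[of u] by simp
        have "ennreal_powr (g u * ennreal (\<phi> u powr (1 / q))) q = ennreal_powr (g u) q * ennreal (\<phi> u)"
          using p pos by (simp add: ennreal_powr_mult ennreal_powr_ennreal powr_powr)
        moreover have "ennreal (1 / u) = ennreal (\<phi> u) * ennreal (1 / (\<phi> u * u))"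
          using p True by (simp flip: ennreal_mult)
        ultimately show ?thesis
          using True by (simp only: N_def) (simp add: ac_simps)
      qed (auto simp: N_def)
    qed
    also have "\<dots> = ennreal (A powr (q - 1) * A) *
        (\<integral>\<^sup>+ u\<in>{0<..<V}. ennreal_powr (g u) q * ennreal (1 / u) \<partial>lborel)"
      by (rule nn_integral_cmult) measurable
    finally show "(\<integral>\<^sup>+ t\<in>{0<..<m}. ennreal_powr (\<integral>\<^sup>+ u. g u * (ennreal (1 / u)
        * indicator {u. 0 < u \<and> u < V \<and> t powr \<delta> < u powr \<epsilon>} u) \<partial>lborel) q
          * ennreal ((1 + ln m - ln t) powr - q / t) \<partial>lborel)
      \<le> ennreal (A powr (q - 1) * A) * (\<integral>\<^sup>+ u\<in>{0<..<V}. ennreal_powr (g u) q * ennreal (1 / u) \<partial>lborel)" .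
  qed (use A in auto)
qed

text \<open>The kernel is cut where the two entries of the minimum agree. On the part with
  u^\<epsilon> \<le> t^\<delta> the logarithmic weight is simply bounded by 1 and
  \<open>Hardy_local\<close> applies; only the other part uses it.\<close>

lemma Hardy_min:
  fixes \<delta> \<epsilon> q V m :: real
  assumes pos: "0 < \<delta>" "0 < \<epsilon>" "1 < q" "0 < m" "0 < V"
  obtains C where "0 < C" "\<And>g. g \<in> borel_measurable borel \<Longrightarrow>
    (\<integral>\<^sup>+ t\<in>{0<..<m}. ennreal_powr (\<integral>\<^sup>+ u\<in>{0<..<V}. g u * ennreal (min 1 (u powr \<epsilon> * t powr - \<delta>) / u) \<partial>lborel) q
          * ennreal ((1 + ln m - ln t) powr - q / t) \<partial>lborel)
    \<le> ennreal C * (\<integral>\<^sup>+ u\<in>{0<..<V}. ennreal_powr (g u) q * ennreal (1 / u) \<partial>lborel)"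
proof -
  obtain C1 where C1: "0 < C1" and log: "\<And>g. g \<in> borel_measurable borel \<Longrightarrow>
    (\<integral>\<^sup>+ t\<in>{0<..<m}. ennreal_powr (\<integral>\<^sup>+ u. g u * (ennreal (1 / u)
        * indicator {u. 0 < u \<and> u < V \<and> t powr \<delta> < u powr \<epsilon>} u) \<partial>lborel) q
          * ennreal ((1 + ln m - ln t) powr - q / t) \<partial>lborel)
    \<le> ennreal C1 * (\<integral>\<^sup>+ u\<in>{0<..<V}. ennreal_powr (g u) q * ennreal (1 / u) \<partial>lborel)"
    using Hardy_log[OF pos] by blast
  define C2 where "C2 = (1 / \<epsilon>) powr (q - 1) / \<delta>"
  have C2: "0 < C2" using pos by (simp add: C2_def)
  show ?thesis
  proof (rule that[of "2 powr q * (C1 + C2)"])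
    fix g :: "real \<Rightarrow> ennreal" assume g[measurable]: "g \<in> borel_measurable borel"
    define N where "N = (\<integral>\<^sup>+ u\<in>{0<..<V}. ennreal_powr (g u) q * ennreal (1 / u) \<partial>lborel)"
    define w where "w t = ennreal ((1 + ln m - ln t) powr - q / t) * indicator {0<..<m} t" for t
    have [measurable]: "w \<in> borel_measurable borel" unfolding w_def by measurable
    define W1 where "W1 t = (\<integral>\<^sup>+ u. g u * (ennreal (1 / u)
        * indicator {u. 0 < u \<and> u < V \<and> t powr \<delta> < u powr \<epsilon>} u) \<partial>lborel)" for t
    define W2 where "W2 t = (\<integral>\<^sup>+ u. g u * (ennreal (u powr \<epsilon> * t powr - \<delta> / u)
        * indicator {u. 0 < u \<and> u < V \<and> u powr \<epsilon> \<le> t powr \<delta>} u) \<partial>lborel)" for t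
    have [measurable]: "W1 \<in> borel_measurable borel" "W2 \<in> borel_measurable borel"
      unfolding W1_def W2_def by measurable
    have I1: "(\<integral>\<^sup>+ t. w t * ennreal_powr (W1 t) q \<partial>lborel) \<le> ennreal C1 * N"
      using log[OF g] by (simp add: w_def W1_def N_def ac_simps)
    have "(\<integral>\<^sup>+ t. w t * ennreal_powr (W2 t) q \<partial>lborel)
      \<le> (\<integral>\<^sup>+ t\<in>{0<..}. ennreal_powr (W2 t) q * ennreal (1 / t) \<partial>lborel)"
    proof (rule nn_integral_mono)
      fix t
      show "w t * ennreal_powr (W2 t) q \<le> ennreal_powr (W2 t) q * ennreal (1 / t) * indicator {0<..} t"
      proof (cases "0 < t \<and> t < m")
        case True
        then have "(1 + ln m - ln t) powr - q \<le> 1 powr - q"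
          using pos by (intro powr_mono2') auto
        then have "(1 + ln m - ln t) powr - q / t \<le> 1 / t"
          using True by (intro divide_right_mono) auto
        then have "ennreal ((1 + ln m - ln t) powr - q / t) * ennreal_powr (W2 t) q
          \<le> ennreal (1 / t) * ennreal_powr (W2 t) q"
          by (intro mult_right_mono ennreal_leI) auto
        then show ?thesis using True by (simp add: w_def mult.commute)
      qed (auto simp: w_def)
    qed
    also have "\<dots> \<le> ennreal C2 * N"
      unfolding W2_def N_def C2_def by (rule Hardy_local[OF g pos(1-3)])
    finally have I2: "(\<integral>\<^sup>+ t. w t * ennreal_powr (W2 t) q \<partial>lborel) \<le> ennreal C2 * N" .
    have split: "(\<integral>\<^sup>+ u\<in>{0<..<V}. g u * ennreal (min 1 (u powr \<epsilon> * t powr - \<delta>) / u) \<partial>lborel) = W1 t + W2 t"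
      if "0 < t" for t
      unfolding W1_def W2_def
    proof (subst nn_integral_add[symmetric])
      show "(\<integral>\<^sup>+ u\<in>{0<..<V}. g u * ennreal (min 1 (u powr \<epsilon> * t powr - \<delta>) / u) \<partial>lborel)
       = (\<integral>\<^sup>+ u. g u * (ennreal (1 / u) * indicator {u. 0 < u \<and> u < V \<and> t powr \<delta> < u powr \<epsilon>} u)
          + g u * (ennreal (u powr \<epsilon> * t powr - \<delta> / u)
        * indicator {u. 0 < u \<and> u < V \<and> u powr \<epsilon> \<le> t powr \<delta>} u) \<partial>lborel)"
        using that by (intro nn_integral_cong) (auto simp: indicator_def min_def powr_minus field_simps)
    qed measurable
    have "(\<integral>\<^sup>+ t\<in>{0<..<m}. ennreal_powr (\<integral>\<^sup>+ u\<in>{0<..<V}. g u * ennreal (min 1 (u powr \<epsilon> * t powr - \<delta>) / u) \<partial>lborel) q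
          * ennreal ((1 + ln m - ln t) powr - q / t) \<partial>lborel)
      = (\<integral>\<^sup>+ t. w t * ennreal_powr (W1 t + W2 t) q \<partial>lborel)"
    proof (rule nn_integral_cong)
      fix t
      show "ennreal_powr (\<integral>\<^sup>+ u\<in>{0<..<V}. g u * ennreal (min 1 (u powr \<epsilon> * t powr - \<delta>) / u) \<partial>lborel) q
          * ennreal ((1 + ln m - ln t) powr - q / t) * indicator {0<..<m} t
        = w t * ennreal_powr (W1 t + W2 t) q"
        using split[of t] by (cases "0 < t \<and> t < m") (auto simp: w_def mult.commute)
    qed
    also have "\<dots> \<le> (\<integral>\<^sup>+ t. ennreal (2 powr q) * (w t * ennreal_powr (W1 t) q + w t * ennreal_powr (W2 t) q) \<partial>lborel)"
    proof (rule nn_integral_mono)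
      fix t
      have "w t * ennreal_powr (W1 t + W2 t) q
        \<le> w t * (ennreal (2 powr q) * (ennreal_powr (W1 t) q + ennreal_powr (W2 t) q))"
        using pos by (intro mult_left_mono ennreal_powr_add_le) auto
      then show "w t * ennreal_powr (W1 t + W2 t) q
        \<le> ennreal (2 powr q) * (w t * ennreal_powr (W1 t) q + w t * ennreal_powr (W2 t) q)"
        by (simp add: distrib_left ac_simps)
    qed
    also have "\<dots> = ennreal (2 powr q) *
        ((\<integral>\<^sup>+ t. w t * ennreal_powr (W1 t) q \<partial>lborel) + (\<integral>\<^sup>+ t. w t * ennreal_powr (W2 t) q \<partial>lborel))"
      by (simp add: nn_integral_cmult nn_integral_add)
    also have "\<dots> \<le> ennreal (2 powr q) * (ennreal C1 * N + ennreal C2 * N)"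
      by (intro mult_left_mono add_mono I1 I2) auto
    also have "\<dots> = ennreal (2 powr q * (C1 + C2)) * N"
      using C1 C2 by (simp add: ennreal_mult distrib_left distrib_right mult.assoc)
    finally show "(\<integral>\<^sup>+ t\<in>{0<..<m}. ennreal_powr (\<integral>\<^sup>+ u\<in>{0<..<V}. g u * ennreal (min 1 (u powr \<epsilon> * t powr - \<delta>) / u) \<partial>lborel) q
          * ennreal ((1 + ln m - ln t) powr - q / t) \<partial>lborel)
    \<le> ennreal (2 powr q * (C1 + C2)) * (\<integral>\<^sup>+ u\<in>{0<..<V}. ennreal_powr (g u) q * ennreal (1 / u) \<partial>lborel)"
      unfolding N_def .
  qed (use C1 C2 in auto)
qed

section \<open>Measures of power ball growth\<close>

text \<open>For r \<le> 1 a smaller exponent makes the power larger; for r > 1 the bound m on the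
  measure of the ball takes over. This explains the constant c + m.\<close>

lemma ball_growth_smaller_exponent:
  fixes \<nu> :: "'a::metric_space measure" and c d D m r :: real
  assumes "emeasure \<nu> (ball x r) \<le> ennreal (c * r powr d)" "emeasure \<nu> (ball x r) \<le> ennreal m"
    and "0 < r" "0 \<le> D" "D \<le> d" "0 \<le> c" "0 \<le> m"
  shows "emeasure \<nu> (ball x r) \<le> ennreal ((c + m) * r powr D)"
proof (cases "r \<le> 1")
  case True
  have "c * r powr d \<le> (c + m) * r powr D"
    using assms True by (intro mult_mono powr_mono') auto
  with assms(1) show ?thesis by (meson ennreal_leI order_trans)
next
  case False
  have "m * 1 \<le> (c + m) * r powr D"
    using assms False by (intro mult_mono ge_one_powr_ge_zero) auto
  with assms(2) show ?thesis by (auto intro: order_trans ennreal_leI)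
qed

lemma finite_measure_ball_growth:
  fixes \<nu> :: "'a::real_normed_vector measure"
  assumes "sets \<nu> = sets borel" "emeasure \<nu> (- \<Omega>) = 0" "open \<Omega>" "bounded \<Omega>"
    and "\<And>x r. 0 < r \<Longrightarrow> emeasure \<nu> (ball x r) \<le> ennreal (c * r powr d)"
  shows "finite_measure \<nu>" "measure \<nu> UNIV = measure \<nu> \<Omega>"
proof -
  obtain r where r: "0 < r" "\<Omega> \<subseteq> ball 0 r"
    using bounded_subset_ballD[OF \<open>bounded \<Omega>\<close>] by blast
  have "emeasure \<nu> \<Omega> \<le> ennreal (c * r powr d)"
    using r assms(1,5) by (intro order_trans[OF emeasure_mono assms(5)[OF r(1), of 0]]) auto
  then have fin: "emeasure \<nu> \<Omega> < top"
    by (meson ennreal_less_top le_less_trans)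
  have "- \<Omega> \<in> null_sets \<nu>"
    using assms by (simp add: null_sets_def)
  moreover have "\<Omega> \<in> sets \<nu>"
    using assms by simp
  ultimately have "emeasure \<nu> (\<Omega> \<union> - \<Omega>) = emeasure \<nu> \<Omega>"
    by (intro emeasure_Un_null_set)
  then have eq: "emeasure \<nu> UNIV = emeasure \<nu> \<Omega>" by simp
  have "space \<nu> = UNIV"
    using sets_eq_imp_space_eq[OF assms(1)] by simp
  then show "finite_measure \<nu>"
    using fin eq by (intro finite_measureI) simp
  show "measure \<nu> UNIV = measure \<nu> \<Omega>"
    using eq by (simp add: measure_def)
qed

section \<open>Assembly of the estimate\<close>

text \<open>The total mass \<open>m\<close> is fixed before C, and \<nu> and f only afterwards. The
  constant built here depends on m through \<open>Cd + m\<close>, from lowering the exponent, and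
  through |ln m|, from \<open>log_scale_comparison\<close>.\<close>

theorem theorem1p8:
  fixes \<Omega> :: "(real ^ 'n) set" and \<alpha> q d Cd m :: real
  assumes "CARD('n) \<ge> 2"
    and "open \<Omega>" and "bounded \<Omega>"
    and "0 < \<alpha>" and "\<alpha> < real CARD('n)"
    and "1 < q"
    and "0 < d" and "d \<le> real CARD('n)"
    and "0 < Cd"
  shows "\<exists>C>0. \<forall>\<nu> :: (real ^ 'n) measure.
    borel_measure_on \<Omega> \<nu> \<longrightarrow>
    (\<forall>x. \<forall>r>0. emeasure \<nu> (ball x r) \<le> ennreal (Cd * r powr d)) \<longrightarrow>
    measure \<nu> \<Omega> = m \<longrightarrow>
    (\<forall>f \<in> lorentz_space \<Omega> (real CARD('n) / \<alpha>) q.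
      ennreal_powr
        (\<integral>\<^sup>+ t\<in>{0<..<measure \<nu> \<Omega>}.
           ennreal_powr (rearrangement \<nu> \<Omega> (riesz_potential \<alpha> (zero_ext \<Omega> f)) t) q
             / ennreal ((1 + \<bar>ln (t / measure \<nu> \<Omega>)\<bar>) powr q)
             / ennreal t \<partial>lborel)
        (1 / q)
      \<le> ennreal C * lorentz_norm \<Omega> (real CARD('n) / \<alpha>) q f)"
proof (cases "0 < m")
  case False
  \<comment> \<open>The range of t is empty, so the left side is 0 and any positive constant
    works.\<close>
  then show ?thesis by (intro exI[of _ 1]) auto
next
  case m: True
  let ?n = "real CARD('n)"
  \<comment> \<open>A growth exponent that is positive, which gives \<epsilon> > 0, and strictly
    below n - \<alpha>, as the far integral requires. The half only secures strictness.\<close>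
  define D where "D = min d ((?n - \<alpha>) / 2)"
  have D: "0 < D" "D \<le> d" "D < ?n - \<alpha>"
    using assms by (auto simp: D_def min_def field_simps)
  define \<gamma> where "\<gamma> = \<alpha> / ?n"
  define \<delta> where "\<delta> = \<alpha> / (?n - D)"
  define \<epsilon> where "\<epsilon> = \<delta> - \<gamma>"
  have \<delta>: "0 < \<delta>" using assms D by (simp add: \<delta>_def)
  have \<epsilon>: "0 < \<epsilon>"
    using assms D by (simp add: \<epsilon>_def \<delta>_def \<gamma>_def divide_strict_left_mono)
  define V where "V = measure lebesgue \<Omega>"
  have V: "0 \<le> V" by (simp add: V_def)
  have \<Omega>: "\<Omega> \<in> lmeasurable"
    using assms by (simp add: lmeasurable_open)
  have c: "0 < Cd + m" using assms m by simp
  have dim: "DIM(real ^ 'n) = CARD('n)" by simp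
  obtain C1 where C1: "0 < C1" and pot:
    "\<And>(\<nu> :: (real ^ 'n) measure) f t. sets \<nu> = sets borel \<Longrightarrow> finite_measure \<nu> \<Longrightarrow>
       (\<And>x r. 0 < r \<Longrightarrow> emeasure \<nu> (ball x r) \<le> ennreal ((Cd + m) * r powr D)) \<Longrightarrow>
       f \<in> borel_measurable (lebesgue_on \<Omega>) \<Longrightarrow> 0 < t \<Longrightarrow>
       rearrangement \<nu> \<Omega> (riesz_potential \<alpha> (zero_ext \<Omega> f)) t
         \<le> ennreal C1 * (\<integral>\<^sup>+ s\<in>{0<..<V}. rearrangement lebesgue \<Omega> (\<lambda>x. ereal (f x)) s *
             ennreal (min (s powr \<gamma>) ((s / t) powr \<delta>) / s) \<partial>lborel)"
  proof (rule rearrangement_riesz_potential_le[of \<alpha> D "Cd + m" \<Omega>], unfold dim, goal_cases)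
    case (6 C)
    show ?case by (rule 6(1)[OF 6(2) 6(3)[folded V_def \<gamma>_def \<delta>_def]])
  qed (use assms D c \<Omega> in auto)
  \<comment> \<open>On \<open>(0, V + 1)\<close> rather than \<open>(0, V)\<close>, as \<open>V = 0\<close> is possible.\<close>
  obtain C2 where C2: "0 < C2" and hardy: "\<And>g. g \<in> borel_measurable borel \<Longrightarrow>
    (\<integral>\<^sup>+ t\<in>{0<..<m}. ennreal_powr (\<integral>\<^sup>+ u\<in>{0<..<V + 1}. g u * ennreal (min 1 (u powr \<epsilon> * t powr - \<delta>) / u) \<partial>lborel) q
          * ennreal ((1 + ln m - ln t) powr - q / t) \<partial>lborel)
    \<le> ennreal C2 * (\<integral>\<^sup>+ u\<in>{0<..<V + 1}. ennreal_powr (g u) q * ennreal (1 / u) \<partial>lborel)"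
    using Hardy_min[of \<delta> \<epsilon> q m "V + 1"] \<delta> \<epsilon> assms m V by auto
  show ?thesis
  proof (intro exI[of _ "C1 * C2 powr (1 / q)"] conjI allI impI ballI)
    fix \<nu> :: "(real ^ 'n) measure" and f
    assume bo: "borel_measure_on \<Omega> \<nu>"
      and growth: "\<forall>x. \<forall>r>0. emeasure \<nu> (ball x r) \<le> ennreal (Cd * r powr d)"
      and \<nu>m: "measure \<nu> \<Omega> = m" and f: "f \<in> lorentz_space \<Omega> (?n / \<alpha>) q"
    have \<nu>: "sets \<nu> = sets borel" "emeasure \<nu> (- \<Omega>) = 0"
      using bo by (auto simp: borel_measure_on_def)
    note fin = finite_measure_ball_growth[OF \<nu> assms(2,3) growth[rule_format]]
    interpret \<nu>: finite_measure \<nu> by (rule fin(1))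
    have growth': "emeasure \<nu> (ball x r) \<le> ennreal ((Cd + m) * r powr D)" if "0 < r" for x r
    proof (rule ball_growth_smaller_exponent)
      have "emeasure \<nu> (ball x r) \<le> emeasure \<nu> UNIV"
        using \<nu> by (intro emeasure_mono) auto
      then show "emeasure \<nu> (ball x r) \<le> ennreal m"
        by (simp add: \<nu>.emeasure_eq_measure fin(2) \<nu>m)
    qed (use growth that D assms m in auto)
    define R where "R = rearrangement lebesgue \<Omega> (\<lambda>x. ereal (f x))"
    have [measurable]: "R \<in> borel_measurable borel" unfolding R_def by measurable
    \<comment> \<open>The factor u^\<gamma> is moved from the kernel to \<open>g\<close>, which
      makes g^q du/u the integrand of the Lorentz norm. The cut-off at V turns integrals over (0, V
      + 1) into integrals over (0, V).\<close>
    define g where "g u = ennreal (u powr \<gamma>) * R u * indicator {0<..<V} u" for u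
    have g[measurable]: "g \<in> borel_measurable borel" unfolding g_def by measurable
    define N where "N = (\<integral>\<^sup>+ u\<in>{0<..<V}. ennreal_powr (ennreal (u powr \<gamma>) * R u) q / ennreal u \<partial>lborel)"
    have norm: "lorentz_norm \<Omega> (?n / \<alpha>) q f = ennreal_powr N (1 / q)"
      by (simp add: lorentz_norm_def N_def R_def V_def \<gamma>_def)
    have div: "x / ennreal u = x * ennreal (1 / u)" if "0 < u" for x u
      using that by (simp add: divide_ennreal_def inverse_ennreal divide_inverse)
    define W where "W t = (\<integral>\<^sup>+ u\<in>{0<..<V + 1}. g u * ennreal (min 1 (u powr \<epsilon> * t powr - \<delta>) / u) \<partial>lborel)" for t
    have W: "rearrangement \<nu> \<Omega> (riesz_potential \<alpha> (zero_ext \<Omega> f)) t \<le> ennreal C1 * W t"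
      if t: "0 < t" for t
    proof -
      have "(\<integral>\<^sup>+ s\<in>{0<..<V}. R s * ennreal (min (s powr \<gamma>) ((s / t) powr \<delta>) / s) \<partial>lborel) = W t"
        unfolding W_def
      proof (rule nn_integral_cong)
        fix s
        show "R s * ennreal (min (s powr \<gamma>) ((s / t) powr \<delta>) / s) * indicator {0<..<V} s
          = g s * ennreal (min 1 (s powr \<epsilon> * t powr - \<delta>) / s) * indicator {0<..<V + 1} s"
        proof (cases "0 < s \<and> s < V")
          case True
          \<comment> \<open>As \<delta> = \<gamma> + \<epsilon>, the factor s^\<gamma> comes out of
            both entries of the minimum.\<close>
          have "(s / t) powr \<delta> = s powr \<gamma> * (s powr \<epsilon> * t powr - \<delta>)"
            using t True by (simp add: \<epsilon>_def powr_divide powr_minus powr_diff divide_simps)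
          then have "min (s powr \<gamma>) ((s / t) powr \<delta>) = s powr \<gamma> * min 1 (s powr \<epsilon> * t powr - \<delta>)"
            by (simp add: min_mult_distrib_left)
          then have "ennreal (min (s powr \<gamma>) ((s / t) powr \<delta>) / s)
              = ennreal (s powr \<gamma>) * ennreal (min 1 (s powr \<epsilon> * t powr - \<delta>) / s)"
            using True by (simp flip: ennreal_mult)
          then show ?thesis using True by (simp add: g_def ac_simps)
        qed (auto simp: g_def)
      qed
      moreover have "f \<in> borel_measurable (lebesgue_on \<Omega>)"
        using f by (simp add: lorentz_space_def)
      then have "rearrangement \<nu> \<Omega> (riesz_potential \<alpha> (zero_ext \<Omega> f)) t \<le> ennreal C1 *
          (\<integral>\<^sup>+ s\<in>{0<..<V}. R s * ennreal (min (s powr \<gamma>) ((s / t) powr \<delta>) / s) \<partial>lborel)"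
        unfolding R_def by (intro pot \<nu> fin growth' t)
      ultimately show ?thesis by simp
    qed
    have "(\<integral>\<^sup>+ t\<in>{0<..<m}. ennreal_powr (rearrangement \<nu> \<Omega> (riesz_potential \<alpha> (zero_ext \<Omega> f)) t) q
             / ennreal ((1 + \<bar>ln (t / m)\<bar>) powr q) / ennreal t \<partial>lborel)
       \<le> (\<integral>\<^sup>+ t. ennreal (C1 powr q) * (ennreal_powr (W t) q * ennreal ((1 + ln m - ln t) powr - q / t)
            * indicator {0<..<m} t) \<partial>lborel)"
    proof (rule nn_integral_mono)
      fix t
      let ?r = "ennreal_powr (rearrangement \<nu> \<Omega> (riesz_potential \<alpha> (zero_ext \<Omega> f)) t) q"
      show "?r / ennreal ((1 + \<bar>ln (t / m)\<bar>) powr q) / ennreal t * indicator {0<..<m} t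
        \<le> ennreal (C1 powr q) * (ennreal_powr (W t) q * ennreal ((1 + ln m - ln t) powr - q / t)
            * indicator {0<..<m} t)"
      proof (cases "0 < t \<and> t < m")
        case True
        then have eq: "1 + \<bar>ln (t / m)\<bar> = 1 + ln m - ln t" and "ln t < ln m"
          by (auto simp: ln_div)
        then have p: "0 < (1 + ln m - ln t) powr q" by simp
        have "?r / ennreal ((1 + \<bar>ln (t / m)\<bar>) powr q) / ennreal t
          = ?r * (ennreal (1 / (1 + ln m - ln t) powr q) * ennreal (1 / t))"
          unfolding eq div[OF p] using True by (simp add: div mult.assoc)
        also have "ennreal (1 / (1 + ln m - ln t) powr q) * ennreal (1 / t)
          = ennreal ((1 + ln m - ln t) powr - q / t)"
          using True by (simp add: powr_minus divide_inverse flip: ennreal_mult)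
        finally have "?r / ennreal ((1 + \<bar>ln (t / m)\<bar>) powr q) / ennreal t
          = ?r * ennreal ((1 + ln m - ln t) powr - q / t)" .
        also have "?r \<le> ennreal_powr (ennreal C1 * W t) q"
          using True assms by (intro ennreal_powr_mono W) auto
        also have "\<dots> = ennreal (C1 powr q) * ennreal_powr (W t) q"
          using C1 by (simp add: ennreal_powr_mult ennreal_powr_ennreal)
        finally show ?thesis
          using True by (simp add: mult_right_mono mult.assoc)
      qed auto
    qed
    also have "\<dots> = ennreal (C1 powr q) * (\<integral>\<^sup>+ t\<in>{0<..<m}. ennreal_powr (W t) q
        * ennreal ((1 + ln m - ln t) powr - q / t) \<partial>lborel)"
      unfolding W_def by (intro nn_integral_cmult) measurable
    also have "\<dots> \<le> ennreal (C1 powr q) *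
        (ennreal C2 * (\<integral>\<^sup>+ u\<in>{0<..<V + 1}. ennreal_powr (g u) q * ennreal (1 / u) \<partial>lborel))"
      unfolding W_def by (intro mult_left_mono hardy g) simp
    also have "(\<integral>\<^sup>+ u\<in>{0<..<V + 1}. ennreal_powr (g u) q * ennreal (1 / u) \<partial>lborel) = N"
      unfolding N_def by (intro nn_integral_cong) (auto simp: g_def indicator_def div)
    finally have "(\<integral>\<^sup>+ t\<in>{0<..<m}. ennreal_powr (rearrangement \<nu> \<Omega> (riesz_potential \<alpha> (zero_ext \<Omega> f)) t) q
             / ennreal ((1 + \<bar>ln (t / m)\<bar>) powr q) / ennreal t \<partial>lborel)
       \<le> ennreal (C1 powr q * C2) * N" (is "?I \<le> _")
      using C2 by (simp add: ennreal_mult mult.assoc)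
    then have "ennreal_powr ?I (1 / q) \<le> ennreal_powr (ennreal (C1 powr q * C2) * N) (1 / q)"
      using assms by (intro ennreal_powr_mono) auto
    also have "\<dots> = ennreal (C1 * C2 powr (1 / q)) * ennreal_powr N (1 / q)"
      using C1 C2 assms by (simp add: ennreal_powr_mult ennreal_powr_ennreal powr_mult powr_powr)
    finally show "ennreal_powr
        (\<integral>\<^sup>+ t\<in>{0<..<measure \<nu> \<Omega>}.
           ennreal_powr (rearrangement \<nu> \<Omega> (riesz_potential \<alpha> (zero_ext \<Omega> f)) t) q
             / ennreal ((1 + \<bar>ln (t / measure \<nu> \<Omega>)\<bar>) powr q)
             / ennreal t \<partial>lborel)
        (1 / q)
      \<le> ennreal (C1 * C2 powr (1 / q)) * lorentz_norm \<Omega> (?n / \<alpha>) q f"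
      unfolding \<nu>m norm .
  qed (use C1 C2 in auto)
qed

end
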